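(* Let $n\ge 1$ and let $M_n=\max_{1\le i\le n}X_i$ be the maximum of $n$ zero-mean jointly Gaussian random variables $X_1,\dots,X_n$. For $1\le i\le n$ define $$E_i=\mathbb{E}(X_i\mid X_1,\dots,X_{i-1}),\qquad R_i=X_i-E_i,\qquad \tau_i^2=\mathbb{E}(E_i^2),\qquad \sigma_i^2=\mathbb{E}(R_i^2)$$ (so $E_1=\mathbb{E}X_1=0$ and $R_1=X_1$), and let $\tau,\sigma\ge 0$ be given by $$\tau^2=\max_{1\le i\le n}\tau_i^2,\qquad \sigma^2=\min_{1\le i\le n}\sigma_i^2 .$$ Let $N=\log(n^2/2\pi)$ and, for $0<\alpha<1$, let $L_\alpha=-2\log(-\log\alpha)$. Then, for every $\alpha\in(0,1)$ with $N+L_\alpha\ge 6$, $$\Pr\left\{M_n\ge \sigma\left(N+L_\alpha-\log(N+L_\alpha)\right)^{1/2}+\tau\,\Phi^{-1}(\alpha)\right\}\ge 1-2\alpha .$$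
   Context: $\Phi$ is the standard normal distribution function and $\Phi^{-1}$ is its inverse. $\log$ is the natural logarithm. *)

theory Defs
  imports "HOL-Probability.Probability"
begin

text \<open>A Gaussian random variable is allowed to be degenerate (almost surely constant), so that
  jointly Gaussian families may have a singular covariance matrix.\<close>

definition gaussian_rv :: "'a measure \<Rightarrow> ('a \<Rightarrow> real) \<Rightarrow> bool" where
  "gaussian_rv M Y \<longleftrightarrow>
     (\<exists>\<mu> s. 0 < s \<and> distributed M lborel Y (normal_density \<mu> s)) \<or>
     (Y \<in> borel_measurable M \<and> (\<exists>\<mu>. AE \<omega> in M. Y \<omega> = \<mu>))"

definition jointly_gaussian :: "'a measure \<Rightarrow> 'i set \<Rightarrow> ('i \<Rightarrow> 'a \<Rightarrow> real) \<Rightarrow> bool" where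
  "jointly_gaussian M I X \<longleftrightarrow>
     (\<forall>i\<in>I. X i \<in> borel_measurable M) \<and>
     (\<forall>a. gaussian_rv M (\<lambda>\<omega>. \<Sum>i\<in>I. a i * X i \<omega>))"

text \<open>The sigma-algebra generated by \<open>X 1, \<dots>, X (i - 1)\<close>. For \<open>i = 1\<close> it is the trivial
  sigma-algebra on \<open>space M\<close>, since the empty product is a one-point space.\<close>

definition past_algebra :: "'a measure \<Rightarrow> (nat \<Rightarrow> 'a \<Rightarrow> real) \<Rightarrow> nat \<Rightarrow> 'a measure" where
  "past_algebra M X i =
     vimage_algebra (space M) (\<lambda>\<omega>. \<lambda>j\<in>{1..<i}. X j \<omega>) (\<Pi>\<^sub>M j\<in>{1..<i}. borel)"

definition predictor :: "'a measure \<Rightarrow> (nat \<Rightarrow> 'a \<Rightarrow> real) \<Rightarrow> nat \<Rightarrow> 'a \<Rightarrow> real" where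
  "predictor M X i = real_cond_exp M (past_algebra M X i) (X i)"

definition innovation :: "'a measure \<Rightarrow> (nat \<Rightarrow> 'a \<Rightarrow> real) \<Rightarrow> nat \<Rightarrow> 'a \<Rightarrow> real" where
  "innovation M X i = (\<lambda>\<omega>. X i \<omega> - predictor M X i \<omega>)"

definition std_normal_cdf :: "real \<Rightarrow> real" where
  "std_normal_cdf = cdf std_normal_distribution"

text \<open>\<open>std_normal_cdf\<close> is a bijection from the reals onto the open interval \<open>(0, 1)\<close>; its
  inverse is meaningful only on that interval.\<close>

definition std_normal_quantile :: "real \<Rightarrow> real" where
  "std_normal_quantile = inv std_normal_cdf"

end

theory Submission
  imports Defs "HOL-Real_Asymp.Real_Asymp"
begin

text \<open>Write \<open>X i = E i + R i\<close> and put \<open>r = \<sigma> * c\<close>, \<open>t = \<tau> * q\<close> with \<open>c\<close> the square root in the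
  statement and \<open>q\<close> the \<open>\<alpha>\<close>-quantile. Let \<open>b k\<close> be the probability that \<open>X 1, \<dots>, X k\<close> all stay
  below \<open>r + t\<close>. Among the outcomes surviving up to \<open>k\<close>, at most probability \<open>\<alpha>\<close> has
  \<open>E (k + 1) < t\<close>; on the others, \<open>R (k + 1) \<ge> r\<close> ends the survival, and \<open>R (k + 1)\<close> is
  independent of the past. With \<open>p = \<Phi>(c)\<close> this gives \<open>b (k + 1) - \<alpha> \<le> p * (b k - \<alpha>)\<close>, hence
  \<open>b n \<le> \<alpha> + p ^ n * (1 - \<alpha>)\<close>, and a sharp lower bound for the Mills ratio yields \<open>p ^ n \<le> \<alpha>\<close>.

  That \<open>R i\<close> is independent of the past is reduced to one-dimensional uniqueness of characteristic
  functions, applied to one coordinate at a time.\<close>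

subsection \<open>The normal tail\<close>

lemma measure_std_normal_singleton: "measure std_normal_distribution {x} = 0"
proof -
  have "emeasure std_normal_distribution {x}
      = (\<integral>\<^sup>+y. ennreal (std_normal_density y) * indicator {x} y \<partial>lborel)"
    by (subst emeasure_density) auto
  also have "\<dots> = 0"
    by (subst nn_integral_0_iff_AE) (use AE_lborel_singleton[of x] in \<open>auto simp: indicator_def\<close>)
  finally show ?thesis by (simp add: measure_def)
qed

lemma measure_std_normal_less: "measure std_normal_distribution {..<x} = std_normal_cdf x"
proof -
  interpret real_distribution std_normal_distribution by (rule real_dist_normal_dist)
  have "{..x} = {..<x} \<union> {x}" by auto
  then have "measure std_normal_distribution {..x} = measure std_normal_distribution {..<x}
      + measure std_normal_distribution {x}"
    by (simp only:) (rule finite_measure_Union, auto)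
  then show ?thesis
    by (simp add: std_normal_cdf_def cdf_def measure_std_normal_singleton)
qed

lemma measure_std_normal_atLeast: "measure std_normal_distribution {x..} = 1 - std_normal_cdf x"
proof -
  interpret real_distribution std_normal_distribution by (rule real_dist_normal_dist)
  have "space std_normal_distribution - {..<x} = {x..}" by auto
  then show ?thesis using prob_compl[of "{..<x}"] by (simp add: measure_std_normal_less)
qed

lemma std_normal_cdf_mono: "x \<le> y \<Longrightarrow> std_normal_cdf x \<le> std_normal_cdf y"
proof -
  interpret real_distribution std_normal_distribution by (rule real_dist_normal_dist)
  show "x \<le> y \<Longrightarrow> ?thesis" unfolding std_normal_cdf_def by (rule cdf_nondecreasing)
qed

lemma std_normal_cdf_nonneg: "0 \<le> std_normal_cdf x"
  by (simp add: std_normal_cdf_def cdf_def)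

lemma std_normal_cdf_le_1: "std_normal_cdf x \<le> 1"
  using measure_std_normal_atLeast[of x] measure_nonneg[of std_normal_distribution "{x..}"] by linarith

lemma distr_std_normal_uminus:
  "distr std_normal_distribution borel uminus = std_normal_distribution"
proof -
  interpret real_distribution std_normal_distribution by (rule real_dist_normal_dist)
  have "distributed std_normal_distribution lborel (\<lambda>x. x) std_normal_density"
    by (auto simp: distributed_def distr_id2)
  from normal_density_affine[OF this, of "-1" 0]
  have "distributed std_normal_distribution lborel uminus std_normal_density"
    by simp
  then have "distr std_normal_distribution lborel uminus = std_normal_distribution"
    by (simp add: distributed_def)
  moreover have "distr std_normal_distribution lborel uminus = distr std_normal_distribution borel uminus"
    by (rule distr_cong) auto
  ultimately show ?thesis by simp
qed

lemma std_normal_cdf_0: "std_normal_cdf 0 = 1 / 2"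
proof -
  have "std_normal_cdf 0 = measure (distr std_normal_distribution borel uminus) {..0}"
    by (simp add: distr_std_normal_uminus std_normal_cdf_def cdf_def)
  also have "\<dots> = measure std_normal_distribution (uminus -` {..0})"
    by (subst measure_distr) auto
  also have "uminus -` {..0} = {0::real..}" by auto
  finally show ?thesis by (simp add: measure_std_normal_atLeast)
qed

text \<open>\<open>inv\<close> returns a preimage as soon as one exists, so only attainment of
  \<open>\<alpha>\<close> is at stake. The distribution function is continuous, because points have
  mass 0, and has limits 0 and 1; the intermediate value theorem does the rest.\<close>

lemma std_normal_cdf_quantile:
  assumes "0 < \<alpha>" "\<alpha> < 1"
  shows "std_normal_cdf (std_normal_quantile \<alpha>) = \<alpha>"
proof -
  interpret real_distribution std_normal_distribution by (rule real_dist_normal_dist)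
  have cont: "isCont std_normal_cdf x" for x
    unfolding std_normal_cdf_def by (simp add: isCont_cdf measure_std_normal_singleton)
  have "eventually (\<lambda>x. std_normal_cdf x < \<alpha>) at_bot"
    unfolding std_normal_cdf_def using order_tendstoD(2)[OF cdf_lim_at_bot assms(1)] .
  then obtain a where a: "std_normal_cdf a < \<alpha>"
    by (auto simp: eventually_at_bot_linorder)
  have "eventually (\<lambda>x. \<alpha> < std_normal_cdf x) at_top"
    unfolding std_normal_cdf_def using order_tendstoD(1)[OF cdf_lim_at_top_prob assms(2)] .
  then obtain b where b: "\<alpha> < std_normal_cdf b"
    by (auto simp: eventually_at_top_linorder)
  have "a \<le> b" using a b std_normal_cdf_mono[of b a] by linarith
  then obtain x where "std_normal_cdf x = \<alpha>"
    using IVT[of std_normal_cdf a \<alpha> b] a b cont by auto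
  then have "\<alpha> \<in> range std_normal_cdf" by auto
  then show ?thesis unfolding std_normal_quantile_def by (rule f_inv_into_f)
qed

text \<open>The sign matters later: multiplying by a nonpositive number reverses inequalities, which
  lets the largest predictor deviation \<open>\<tau>\<close> serve for all predictors at
  once.\<close>

lemma std_normal_quantile_nonpos:
  assumes "0 < \<alpha>" "\<alpha> < 1 / 2"
  shows "std_normal_quantile \<alpha> \<le> 0"
proof (rule ccontr)
  assume "\<not> ?thesis"
  then have "1 / 2 \<le> std_normal_cdf (std_normal_quantile \<alpha>)"
    using std_normal_cdf_mono[of 0 "std_normal_quantile \<alpha>"] by (simp add: std_normal_cdf_0)
  then show False using std_normal_cdf_quantile[of \<alpha>] assms by auto
qed

section \<open>Lower bound for the Mills ratio\<close>

lemma has_real_derivative_std_normal_density: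
  "(std_normal_density has_real_derivative - x * std_normal_density x) (at x)"
  unfolding std_normal_density_def
  by (auto intro!: derivative_eq_intros simp: field_simps)

lemma std_normal_density_tendsto_0: "(std_normal_density \<longlongrightarrow> 0) at_top"
  unfolding std_normal_density_def[abs_def] by real_asymp

text \<open>The rational function is a convergent of Laplace's continued fraction for the Mills ratio. The
  simpler lower bounds \<open>x / (x\<^sup>2 + 1)\<close> and \<open>2 / (x + sqrt (x\<^sup>2 + 4))\<close> are too weak for the tail
  estimate below when \<open>u\<close> is close to \<open>6\<close>.\<close>

lemma mills_ratio_lower_bound:
  assumes "1 \<le> x"
  shows "std_normal_density x * ((x^3 + 5*x) / (x^4 + 6*x^2 + 3)) \<le> 1 - std_normal_cdf x"
proof -
  interpret real_distribution std_normal_distribution by (rule real_dist_normal_dist)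
  define Q where "Q y = y^4 + 6*y^2 + 3" for y :: real
  define r where "r y = (y^3 + 5*y) / Q y" for y :: real
  \<comment> \<open>\<open>F\<close> is minus the claimed bound and \<open>f\<close> is its
    derivative. The convergent almost solves the differential equation of the Mills ratio:
    \<open>y * r y\<close> minus the derivative of \<open>r\<close> is
    \<open>1 - 24 / (Q y)^2\<close> instead of 1. Hence \<open>f\<close> stays below the
    density.\<close>
  define F where "F y = - (std_normal_density y * r y)" for y
  define f where "f y = std_normal_density y * (1 - 24 / (Q y)^2)" for y
  have Qpos: "0 < Q y" for y unfolding Q_def by (auto intro!: add_nonneg_pos)
  \<comment> \<open>With \<open>Q y\<close> at least 10 the defect \<open>24 / (Q y)^2\<close> is
    below 1, so \<open>f\<close> is nonnegative on the half-line. This is where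
    \<open>1 \<le> x\<close> enters.\<close>
  have Q10: "10 \<le> Q y" if "1 \<le> y" for y
    using that one_le_power[of y 4] one_le_power[of y 2] unfolding Q_def by linarith
  have [measurable]: "f \<in> borel_measurable borel" unfolding f_def Q_def by measurable
  have deriv: "DERIV F y :> f y" for y
  proof -
    have Qne: "Q y \<noteq> 0" using Qpos[of y] by simp
    have Qd: "(Q has_real_derivative 4*y^3 + 12*y) (at y)"
      unfolding Q_def by (auto intro!: derivative_eq_intros)
    have rd: "(r has_real_derivative ((3*y^2+5) * Q y - (y^3+5*y) * (4*y^3+12*y)) / (Q y * Q y)) (at y)"
      unfolding r_def using Qne by (auto intro!: derivative_eq_intros Qd)
    have "(F has_real_derivative - (std_normal_density y * (((3*y^2+5) * Q y - (y^3+5*y) * (4*y^3+12*y)) / (Q y * Q y)) + (- y * std_normal_density y) * r y)) (at y)"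
      unfolding F_def
      by (rule DERIV_minus, rule DERIV_cong[OF DERIV_mult[OF has_real_derivative_std_normal_density rd]]) simp
    moreover have "- (((3*y^2+5) * Q y - (y^3+5*y) * (4*y^3+12*y)) / (Q y * Q y)) + y * r y = 1 - 24 / (Q y)^2"
    proof -
      have "(- ((3*y^2+5) * Q y - (y^3+5*y) * (4*y^3+12*y)) + y * (y^3+5*y) * Q y) = (Q y)^2 - 24"
        unfolding Q_def by (simp add: algebra_simps power2_eq_square power3_eq_cube power4_eq_xxxx)
      then have "(- ((3*y^2+5) * Q y - (y^3+5*y) * (4*y^3+12*y)) + (y * (y^3+5*y)) * Q y) / (Q y)^2
          = 1 - 24 / (Q y)^2"
        using Qne by (simp add: diff_divide_distrib)
      moreover have "y * r y = (y * (y^3+5*y)) * Q y / (Q y)^2"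
        unfolding r_def using Qne by (simp add: power2_eq_square)
      moreover have "- (((3*y^2+5) * Q y - (y^3+5*y) * (4*y^3+12*y)) / (Q y * Q y)) + (y * (y^3+5*y)) * Q y / (Q y)^2
          = (- ((3*y^2+5) * Q y - (y^3+5*y) * (4*y^3+12*y)) + (y * (y^3+5*y)) * Q y) / (Q y)^2"
        by (simp only: power2_eq_square add_divide_distrib minus_divide_left)
      ultimately show ?thesis by (simp only:)
    qed
    moreover have "- (d * k + (- y * d) * s) = d * (- k + y * s)" for d k s :: real
      by (simp add: algebra_simps)
    ultimately show ?thesis unfolding f_def by (simp only:)
  qed
  have nonneg: "0 \<le> f y" if "x \<le> y" for y
  proof -
    have "10 \<le> Q y" using that assms Q10 by auto
    then have "10^2 \<le> (Q y)^2" by (intro power_mono) auto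
    then show ?thesis unfolding f_def by (intro mult_nonneg_nonneg) (auto simp: divide_le_eq)
  qed
  have "(r \<longlongrightarrow> 0) at_top" unfolding r_def Q_def by real_asymp
  then have lim: "(F \<longlongrightarrow> 0) at_top"
    unfolding F_def using tendsto_minus[OF tendsto_mult[OF std_normal_density_tendsto_0]] by force
  \<comment> \<open>As \<open>F\<close> tends to 0, the integral of \<open>f\<close> over the
    half-line is \<open>- F x\<close>; enlarging \<open>f\<close> to the density turns the integral
    into the normal tail.\<close>
  have "ennreal (- F x) = (\<integral>\<^sup>+y. ennreal (f y) * indicator {x..} y \<partial>lborel)"
    using nn_integral_FTC_atLeast[of f x F 0] deriv nonneg lim by simp
  also have "\<dots> \<le> (\<integral>\<^sup>+y. ennreal (std_normal_density y) * indicator {x..} y \<partial>lborel)"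
    by (intro nn_integral_mono mult_right_mono ennreal_leI) (auto simp: f_def intro!: mult_left_le)
  also have "\<dots> = emeasure std_normal_distribution {x..}"
    by (subst emeasure_density) auto
  also have "\<dots> = ennreal (measure std_normal_distribution {x..})"
    by (rule emeasure_eq_measure)
  finally have "- F x \<le> measure std_normal_distribution {x..}"
    by (simp add: ennreal_le_iff)
  then show ?thesis by (simp add: measure_std_normal_atLeast F_def r_def Q_def)
qed

section \<open>The normal tail at the threshold \<open>sqrt (u - ln u)\<close>\<close>

lemma ln_6_ge: "16 / 9 \<le> ln (6::real)"
proof -
  \<comment> \<open>The fraction comes from comparing \<open>exp 1 ^ 16\<close> with
    \<open>6 ^ 9\<close>. It is sharp enough to keep \<open>10*lam - 17\<close> and
    \<open>25*lam - 36\<close> positive in \<open>std_normal_tail_ge\<close>.\<close>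
  have "exp 1 ^ 16 \<le> (2.72::real) ^ 16" using e_less_272 by (intro power_mono) auto
  also have "\<dots> \<le> 6 ^ 9" by (simp add: power_divide divide_le_eq)
  finally have "exp 1 ^ 16 \<le> (6::real) ^ 9" .
  then have "ln (exp 1 ^ 16) \<le> ln ((6::real) ^ 9)" by (subst ln_le_cancel_iff) simp_all
  then have "16 * ln (exp 1) \<le> 9 * ln (6::real)" by (simp only: ln_realpow of_nat_numeral)
  then show ?thesis by simp
qed

lemma ln_6_le: "ln (6::real) \<le> 9 / 5"
proof -
  have e: "2.71 \<le> (exp 1 :: real)"
    using e_approx_32 by (simp add: abs_if split: if_split_asm)
  \<comment> \<open>The upper estimate serves to bound \<open>u - ln u\<close> from below.\<close>
  have "(6::real) ^ 5 \<le> 2.71 ^ 9" by (simp add: power_divide le_divide_eq)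
  also have "\<dots> \<le> exp 1 ^ 9" using e by (rule power_mono) simp
  finally have "(6::real) ^ 5 \<le> exp 1 ^ 9" .
  then have "ln ((6::real) ^ 5) \<le> ln (exp 1 ^ 9)" by (subst ln_le_cancel_iff) simp_all
  then have "5 * ln (6::real) \<le> 9 * ln (exp 1)" by (simp only: ln_realpow of_nat_numeral)
  then show ?thesis by simp
qed

text \<open>Since \<open>c^2 = u - ln u\<close>, the left side is the density at \<open>c\<close>
  divided by \<open>sqrt u\<close>. It remains to compare \<open>1 / sqrt u\<close> with the
  rational Mills bound at \<open>c\<close>, which after squaring is a polynomial inequality in
  \<open>w = c^2\<close> and \<open>lam = ln u\<close>.\<close>

lemma std_normal_tail_ge:
  assumes u: "6 \<le> u" and c: "c = sqrt (u - ln u)"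
  shows "exp (- u / 2) / sqrt (2 * pi) \<le> 1 - std_normal_cdf c"
proof -
  define lam where "lam = ln u"
  define w where "w = u - lam"
  have lam: "16 / 9 \<le> lam" unfolding lam_def using ln_6_ge u by (smt (verit) ln_mono)
  \<comment> \<open>The tangent to the logarithm at 6 bounds \<open>ln u\<close> by
    \<open>4 / 5 + u / 6\<close>, so \<open>w\<close> is at least \<open>5 * u / 6 - 4 / 5\<close>,
    which exceeds 4.\<close>
  have "ln u = ln 6 + ln (u / 6)" using u by (simp add: ln_div)
  also have "\<dots> \<le> 9 / 5 + (u / 6 - 1)" using ln_6_le ln_le_minus_one[of "u / 6"] u by linarith
  finally have w4: "4 \<le> w" using u unfolding w_def lam_def by linarith
  have c2: "c^2 = w" using w4 unfolding c w_def lam_def by simp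
  have cpos: "2 \<le> c" using w4 unfolding c w_def lam_def by (intro real_le_rsqrt) auto
  \<comment> \<open>This is the squared comparison with \<open>u = w + lam\<close> inserted; the
    fourth powers of \<open>w\<close> cancel. Only the cubic coefficient can be negative, and its
    sign changes at \<open>lam = 2\<close>.\<close>
  have key: "9 \<le> (lam - 2) * w^3 + (10*lam - 17) * w^2 + (25*lam - 36) * w"
  proof (cases "2 \<le> lam")
    case True
    \<comment> \<open>Here \<open>10*lam - 17\<close> is at least 3 and the other two terms are
      nonnegative.\<close>
    have "9 \<le> 3 * w^2" using power_mono[OF w4, of 2] by simp
    also have "\<dots> \<le> (10*lam - 17) * w^2" using True by (intro mult_right_mono) auto
    also have "\<dots> \<le> (lam - 2) * w^3 + (10*lam - 17) * w^2 + (25*lam - 36) * w"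
      using True w4 by simp
    finally show ?thesis .
  next
    case False
    \<comment> \<open>A small \<open>lam\<close> means a small \<open>u\<close>, and this forces
      \<open>w \<le> 6\<close>. With one factor \<open>w\<close> taken out, the negative term is at
      least -8, while the other two contribute at least \<open>28 / 9\<close> and
      \<open>76 / 9\<close>.\<close>
    have "u = exp lam" using u unfolding lam_def by simp
    also have "\<dots> \<le> exp 1 ^ 2" using False by (simp add: power2_eq_square flip: exp_add)
    also have "\<dots> \<le> 2.75 ^ 2" using e_less_272 by (intro power_mono) auto
    finally have w6: "w \<le> 6" using lam unfolding w_def by (simp add: power2_eq_square)
    have "w^2 \<le> 36" using w6 w4 power_mono[of w 6 2] by simp
    then have "(2 - lam) * w^2 \<le> 2 / 9 * 36" using lam False by (intro mult_mono) auto
    moreover have "7 / 9 * 4 \<le> (10*lam - 17) * w" by (rule mult_mono) (use lam w4 in auto)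
    ultimately have "3 \<le> (lam - 2) * w^2 + (10*lam - 17) * w + (25*lam - 36)" using lam by (simp add: algebra_simps)
    then have "3 * 4 \<le> ((lam - 2) * w^2 + (10*lam - 17) * w + (25*lam - 36)) * w"
      using w4 by (intro mult_mono) auto
    then show ?thesis by (simp add: algebra_simps power2_eq_square power3_eq_cube)
  qed
  have "(w^2 + 6*w + 3)^2 \<le> w * (w + 5)^2 * u"
  proof -
    have "w * (w + 5)^2 * (w + lam) - (w^2 + 6*w + 3)^2
        = (lam - 2) * w^3 + (10*lam - 17) * w^2 + (25*lam - 36) * w - 9"
      by (simp add: algebra_simps power2_eq_square power3_eq_cube)
    then show ?thesis using key by (simp add: w_def)
  qed
  then have "sqrt ((w^2 + 6*w + 3)^2) \<le> sqrt (w * (w + 5)^2 * u)" by (rule real_sqrt_le_mono)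
  then have "w^2 + 6*w + 3 \<le> sqrt w * (w + 5) * sqrt u"
    using w4 by (simp add: real_sqrt_mult)
  moreover have "sqrt w = c" using c unfolding w_def lam_def by simp
  moreover have "c^4 = w^2" "c^3 = c * w" using c2 by (auto simp: power2_eq_square power3_eq_cube power4_eq_xxxx)
  ultimately have "c^4 + 6*c^2 + 3 \<le> (c^3 + 5*c) * sqrt u" using c2 by (simp add: algebra_simps)
  moreover have "0 < c^4 + 6*c^2 + 3" by (auto intro!: add_nonneg_pos)
  ultimately have frac: "1 / sqrt u \<le> (c^3 + 5*c) / (c^4 + 6*c^2 + 3)"
    using u by (simp add: divide_le_eq le_divide_eq)
  have "exp (- u / 2) / sqrt (2 * pi) = std_normal_density c * (1 / sqrt u)"
  proof -
    have "exp (- w / 2) = exp (- u / 2) * exp (lam / 2)"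
      by (simp add: w_def diff_divide_distrib flip: exp_add)
    moreover have "sqrt u = exp (lam / 2)"
    proof (rule real_sqrt_unique)
      show "exp (lam / 2) ^ 2 = u" using u unfolding lam_def by (simp flip: exp_double)
    qed simp
    ultimately have "exp (- w / 2) = exp (- u / 2) * sqrt u" by simp
    then show ?thesis using u c2 by (simp add: std_normal_density_def)
  qed
  also have "\<dots> \<le> std_normal_density c * ((c^3 + 5*c) / (c^4 + 6*c^2 + 3))"
    using frac by (intro mult_left_mono) auto
  also have "\<dots> \<le> 1 - std_normal_cdf c" using mills_ratio_lower_bound[of c] cpos by simp
  finally show ?thesis .
qed

text \<open>The number \<open>u\<close> is chosen so that
  \<open>exp (- u / 2) / sqrt (2 * pi)\<close> equals \<open>- ln \<alpha> / n\<close>. The tail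
  estimate then bounds the distribution function by \<open>1 + ln \<alpha> / n\<close>, hence by
  \<open>exp (ln \<alpha> / n)\<close>, whose \<open>n\<close>-th power is
  \<open>\<alpha>\<close>.\<close>

lemma std_normal_cdf_power_le:
  assumes n: "1 \<le> n" and \<alpha>: "0 < \<alpha>" "\<alpha> < 1"
    and u: "u = ln ((real n)\<^sup>2 / (2 * pi)) - 2 * ln (- ln \<alpha>)" "6 \<le> u"
  shows "std_normal_cdf (sqrt (u - ln u)) ^ n \<le> \<alpha>"
proof -
  let ?c = "sqrt (u - ln u)"
  have l: "0 < - ln \<alpha>" using \<alpha> by simp
  have "exp (- u / 2) = sqrt (2 * pi) * (- ln \<alpha>) / n"
  proof -
    have "- u / 2 = ln (sqrt (2 * pi) * (- ln \<alpha>) / n)"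
    proof -
      have "ln (sqrt (2 * pi) * (- ln \<alpha>) / n) = ln (2 * pi) / 2 + ln (- ln \<alpha>) - ln n"
        using n l by (subst ln_div; (subst ln_mult)?) (auto simp: ln_sqrt)
      moreover have "ln ((real n)\<^sup>2 / (2 * pi)) = 2 * ln n - ln (2 * pi)"
        using n by (subst ln_div) (auto simp: ln_realpow)
      ultimately show ?thesis using u by simp
    qed
    moreover have "0 < sqrt (2 * pi) * (- ln \<alpha>) / n" using n l by (intro divide_pos_pos mult_pos_pos) auto
    ultimately show ?thesis by simp
  qed
  then have "- ln \<alpha> / n = exp (- u / 2) / sqrt (2 * pi)" by simp
  also have "\<dots> \<le> 1 - std_normal_cdf ?c" by (rule std_normal_tail_ge[OF u(2) refl])
  finally have "std_normal_cdf ?c \<le> 1 + ln \<alpha> / n" by simp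
  also have "\<dots> \<le> exp (ln \<alpha> / n)" by (rule exp_ge_add_one_self)
  finally have "std_normal_cdf ?c ^ n \<le> exp (ln \<alpha> / n) ^ n"
    by (intro power_mono std_normal_cdf_nonneg)
  also have "\<dots> = \<alpha>" using n \<alpha> by (simp flip: exp_of_nat_mult)
  finally show ?thesis .
qed

subsection \<open>Independence from characteristic functions\<close>

text \<open>This is uniqueness of the Fourier transform for the signed law of \<open>Y\<close> with
  weight \<open>u\<close>. The positive and negative parts of \<open>u\<close> have equal
  transforms, so once normalized they give \<open>Y\<close> the same law by Levy's theorem.\<close>

lemma (in prob_space) expectation_indicator_eq_0_real:
  fixes u Y :: "'a \<Rightarrow> real"
  assumes [measurable]: "integrable M u" "Y \<in> borel_measurable M" "A \<in> sets borel"
    and ch: "\<And>t. (CLINT \<omega>|M. u \<omega> * iexp (t * Y \<omega>)) = 0"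
  shows "(\<integral>\<omega>. u \<omega> * indicator A (Y \<omega>) \<partial>M) = 0"
proof -
  define p where "p \<omega> = max 0 (u \<omega>)" for \<omega>
  define m where "m \<omega> = max 0 (- u \<omega>)" for \<omega>
  have int [measurable]: "integrable M p" "integrable M m"
    unfolding p_def m_def using assms(1) by auto
  have nn: "0 \<le> p \<omega>" "0 \<le> m \<omega>" for \<omega> by (auto simp: p_def m_def)
  have u: "u \<omega> = p \<omega> - m \<omega>" for \<omega> by (auto simp: p_def m_def)
  have intc: "integrable M (\<lambda>\<omega>. complex_of_real (f \<omega>) * iexp (t * Y \<omega>))"
    if "integrable M f" for f :: "'a \<Rightarrow> real" and t
  proof (rule Bochner_Integration.integrable_bound[OF that])
    show "(\<lambda>\<omega>. complex_of_real (f \<omega>) * iexp (t * Y \<omega>)) \<in> borel_measurable M"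
      using that by measurable
  qed (simp add: norm_mult)
  have inti: "integrable M (\<lambda>\<omega>. f \<omega> * indicator A (Y \<omega>))"
    if "integrable M f" for f :: "'a \<Rightarrow> real"
  proof (rule Bochner_Integration.integrable_bound[OF that])
    show "(\<lambda>\<omega>. f \<omega> * indicator A (Y \<omega>)) \<in> borel_measurable M"
      using that by measurable
  qed (simp add: indicator_def)
  have eq: "(CLINT \<omega>|M. p \<omega> * iexp (t * Y \<omega>)) = (CLINT \<omega>|M. m \<omega> * iexp (t * Y \<omega>))" for t
    using ch[of t] intc[OF int(1)] intc[OF int(2)]
    by (simp add: u left_diff_distrib)
  define c where "c = (\<integral>\<omega>. p \<omega> \<partial>M)"
  \<comment> \<open>At \<open>t = 0\<close> the transforms are the total masses, so one constant
    normalizes both parts. Mass 0 is treated separately, as nothing can be normalized there.\<close>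
  have c: "c = (\<integral>\<omega>. m \<omega> \<partial>M)" using eq[of 0] by (simp add: c_def)
  show ?thesis
  proof (cases "c = 0")
    case True
    then have "AE \<omega> in M. p \<omega> = 0" "AE \<omega> in M. m \<omega> = 0"
      using integral_nonneg_eq_0_iff_AE[OF int(1)] integral_nonneg_eq_0_iff_AE[OF int(2)] nn
      by (simp_all add: c c_def[symmetric])
    then have "AE \<omega> in M. u \<omega> * indicator A (Y \<omega>) = 0" by eventually_elim (simp add: u)
    then show ?thesis by (simp add: integral_eq_zero_AE)
  next
    case False
    then have cpos: "0 < c" using nn unfolding c_def by (simp add: less_le)
    \<comment> \<open>\<open>D f\<close> is the law of \<open>Y\<close> under the probability
      measure with density \<open>f / c\<close>.\<close>
    define D where "D f = distr (density M (\<lambda>\<omega>. ennreal (f \<omega> / c))) borel Y" for f :: "'a \<Rightarrow> real"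
    have real_distribution_D: "real_distribution (D f)"
      if "integrable M f" "\<And>\<omega>. 0 \<le> f \<omega>" "(\<integral>\<omega>. f \<omega> \<partial>M) = c" for f
    proof -
      have [measurable]: "f \<in> borel_measurable M" using that by auto
      have "emeasure (density M (\<lambda>\<omega>. ennreal (f \<omega> / c))) (space M) = 1"
        using that cpos by (simp add: emeasure_density nn_integral_eq_integral cong: nn_integral_cong)
      then interpret D: prob_space "density M (\<lambda>\<omega>. ennreal (f \<omega> / c))"
        by (intro prob_spaceI) simp
      show ?thesis unfolding D_def by (rule D.real_distribution_distr) simp
    qed
    have char_D: "char (D f) t = (CLINT \<omega>|M. f \<omega> * iexp (t * Y \<omega>)) / c"
      if "integrable M f" "\<And>\<omega>. 0 \<le> f \<omega>" for f t
    proof -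
      have [measurable]: "f \<in> borel_measurable M" using that by auto
      have "char (D f) t = (CLINT \<omega>|M. (f \<omega> / c) *\<^sub>R iexp (t * Y \<omega>))"
        unfolding D_def char_def using that cpos
        by (subst integral_distr, simp, simp, subst integral_density) auto
      also have "\<dots> = (CLINT \<omega>|M. f \<omega> * iexp (t * Y \<omega>) / c)"
        by (simp add: scaleR_conv_of_real)
      finally show ?thesis by simp
    qed
    have measure_D: "measure (D f) A = (\<integral>\<omega>. f \<omega> * indicator A (Y \<omega>) \<partial>M) / c"
      if "integrable M f" "\<And>\<omega>. 0 \<le> f \<omega>" for f
    proof -
      have [measurable]: "f \<in> borel_measurable M" using that by auto
      have "measure (D f) A = (\<integral>x. indicator A x \<partial>D f)" by (simp add: D_def)
      also have "\<dots> = (\<integral>\<omega>. (f \<omega> / c) *\<^sub>R indicator A (Y \<omega>) \<partial>M)"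
        unfolding D_def using that cpos
        by (subst integral_distr, simp, simp, subst integral_density) auto
      finally show ?thesis by simp
    qed
    have "D p = D m"
      by (intro Levy_uniqueness real_distribution_D int nn)
         (simp_all add: fun_eq_iff char_D int nn eq c_def[symmetric] c[symmetric] del: of_real_mult)
    then have "(\<integral>\<omega>. p \<omega> * indicator A (Y \<omega>) \<partial>M) = (\<integral>\<omega>. m \<omega> * indicator A (Y \<omega>) \<partial>M)"
      using measure_D[OF int(1) nn(1)] measure_D[OF int(2) nn(2)] cpos by simp
    then show ?thesis using inti[OF int(1)] inti[OF int(2)] by (simp add: u left_diff_distrib)
  qed
qed

text \<open>The transform of \<open>cnj U\<close> at \<open>t\<close> is the conjugate of that of
  \<open>U\<close> at \<open>- t\<close>, so it vanishes as well. Hence the real and imaginary parts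
  of \<open>U\<close> satisfy the hypothesis of the real case. Complex weights are needed because
  exponentials will be absorbed into \<open>U\<close>.\<close>

lemma (in prob_space) expectation_indicator_eq_0:
  fixes U :: "'a \<Rightarrow> complex" and Y :: "'a \<Rightarrow> real"
  assumes int: "integrable M U" and [measurable]: "Y \<in> borel_measurable M" "A \<in> sets borel"
    and ch: "\<And>t. (CLINT \<omega>|M. U \<omega> * iexp (t * Y \<omega>)) = 0"
  shows "(CLINT \<omega>|M. U \<omega> * indicator A (Y \<omega>)) = 0"
proof -
  have [measurable]: "U \<in> borel_measurable M" using int by auto
  have intU: "integrable M (\<lambda>\<omega>. U \<omega> * iexp (t * Y \<omega>))" for t
    by (rule Bochner_Integration.integrable_bound[OF int]) (auto simp: norm_mult)
  have intA: "integrable M (\<lambda>\<omega>. U \<omega> * indicator A (Y \<omega>))"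
    by (rule Bochner_Integration.integrable_bound[OF int]) (auto simp: norm_mult indicator_def)
  have cnj: "(CLINT \<omega>|M. cnj (U \<omega>) * iexp (t * Y \<omega>)) = 0" for t
  proof -
    have "(CLINT \<omega>|M. cnj (U \<omega>) * iexp (t * Y \<omega>)) = (CLINT \<omega>|M. cnj (U \<omega> * iexp (- t * Y \<omega>)))"
      by (simp add: exp_cnj)
    also have "\<dots> = cnj (CLINT \<omega>|M. U \<omega> * iexp (- t * Y \<omega>))" by (rule Bochner_Integration.integral_cnj)
    finally show ?thesis using ch[of "- t"] by simp
  qed
  have [measurable]: "(\<lambda>\<omega>. cnj (U \<omega>)) \<in> borel_measurable M"
    using int by (intro borel_measurable_integrable) simp
  have intU': "integrable M (\<lambda>\<omega>. cnj (U \<omega>) * iexp (t * Y \<omega>))" for t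
    by (rule Bochner_Integration.integrable_bound[OF int]) (auto simp: norm_mult)
  have re: "(CLINT \<omega>|M. complex_of_real (Re (U \<omega>)) * iexp (t * Y \<omega>)) = 0" for t
  proof -
    have "complex_of_real (Re z) * w = (z * w + cnj z * w) / 2" for z w
      by (simp add: complex_eq_iff)
    then have "(CLINT \<omega>|M. complex_of_real (Re (U \<omega>)) * iexp (t * Y \<omega>))
        = (CLINT \<omega>|M. (U \<omega> * iexp (t * Y \<omega>) + cnj (U \<omega>) * iexp (t * Y \<omega>)) / 2)" by (simp only:)
    then show ?thesis using intU[of t] intU'[of t] ch[of t] cnj[of t] by simp
  qed
  have im: "(CLINT \<omega>|M. complex_of_real (Im (U \<omega>)) * iexp (t * Y \<omega>)) = 0" for t
  proof -
    have "complex_of_real (Im z) * w = (z * w - cnj z * w) / (2 * \<i>)" for z w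
      by (simp add: complex_eq_iff Re_divide Im_divide)
    then have "(CLINT \<omega>|M. complex_of_real (Im (U \<omega>)) * iexp (t * Y \<omega>))
        = (CLINT \<omega>|M. (U \<omega> * iexp (t * Y \<omega>) - cnj (U \<omega>) * iexp (t * Y \<omega>)) / (2 * \<i>))" by (simp only:)
    then show ?thesis using intU[of t] intU'[of t] ch[of t] cnj[of t] by simp
  qed
  have "(\<integral>\<omega>. Re (U \<omega>) * indicator A (Y \<omega>) \<partial>M) = 0" "(\<integral>\<omega>. Im (U \<omega>) * indicator A (Y \<omega>) \<partial>M) = 0"
    by (intro expectation_indicator_eq_0_real re im; use int in simp)+
  moreover have "Re (CLINT \<omega>|M. U \<omega> * indicator A (Y \<omega>)) = (\<integral>\<omega>. Re (U \<omega>) * indicator A (Y \<omega>) \<partial>M)"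
    by (subst integral_Re[symmetric]) (use intA in \<open>auto simp: indicator_def if_distrib intro!: Bochner_Integration.integral_cong\<close>)
  moreover have "Im (CLINT \<omega>|M. U \<omega> * indicator A (Y \<omega>)) = (\<integral>\<omega>. Im (U \<omega>) * indicator A (Y \<omega>) \<partial>M)"
    by (subst integral_Im[symmetric]) (use intA in \<open>auto simp: indicator_def if_distrib intro!: Bochner_Integration.integral_cong\<close>)
  ultimately show ?thesis by (simp add: complex_eq_iff)
qed

text \<open>Exponentials are exchanged for indicators one coordinate at a time. The weight
  \<open>U\<close> is kept arbitrary in the induction so that it can absorb the indicator of the
  coordinate just treated.\<close>

lemma (in prob_space) expectation_box_eq_0:
  fixes U :: "'a \<Rightarrow> complex" and V :: "'i \<Rightarrow> 'a \<Rightarrow> real"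
  assumes "finite I" "integrable M U" "\<And>i. i \<in> I \<Longrightarrow> V i \<in> borel_measurable M"
    and "\<And>i. i \<in> I \<Longrightarrow> B i \<in> sets borel"
    and "\<And>a. (CLINT \<omega>|M. U \<omega> * iexp (\<Sum>i\<in>I. a i * V i \<omega>)) = 0"
  shows "(CLINT \<omega>|M. U \<omega> * (\<Prod>i\<in>I. indicator (B i) (V i \<omega>))) = 0"
  using assms
proof (induction I arbitrary: U rule: finite_induct)
  case empty
  then show ?case by simp
next
  case (insert j I)
  note [measurable] = insert.prems(2)[of j] insert.prems(3)[of j]
  have [measurable]: "U \<in> borel_measurable M" using insert.prems(1) by auto
  have V [measurable]: "i \<in> I \<Longrightarrow> V i \<in> borel_measurable M" for i using insert.prems(2) by auto
  let ?U = "\<lambda>\<omega>. U \<omega> * indicator (B j) (V j \<omega>)"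
  have "(CLINT \<omega>|M. ?U \<omega> * (\<Prod>i\<in>I. indicator (B i) (V i \<omega>))) = 0"
  proof (rule insert.IH)
    show "integrable M ?U"
      by (rule Bochner_Integration.integrable_bound[OF insert.prems(1)])
         (auto simp: norm_mult indicator_def)
    fix a
    \<comment> \<open>The exponential in the remaining coordinates is frozen into the weight, which
      leaves a one-dimensional problem in \<open>V j\<close>.\<close>
    let ?W = "\<lambda>\<omega>. U \<omega> * iexp (\<Sum>i\<in>I. a i * V i \<omega>)"
    have "(CLINT \<omega>|M. ?W \<omega> * indicator (B j) (V j \<omega>)) = 0"
    proof (rule expectation_indicator_eq_0)
      show "integrable M ?W"
        by (rule Bochner_Integration.integrable_bound[OF insert.prems(1)]) (auto simp: norm_mult)
      fix t
      \<comment> \<open>Since \<open>j\<close> is not in \<open>I\<close>, the coefficient at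
        \<open>j\<close> can be set to \<open>t\<close> without changing the sum over
        \<open>I\<close>.\<close>
      have "(\<Sum>i\<in>I. (if i = j then t else a i) * V i \<omega>) = (\<Sum>i\<in>I. a i * V i \<omega>)" for \<omega>
        using insert.hyps by (intro sum.cong) auto
      then have "?W \<omega> * iexp (t * V j \<omega>)
          = U \<omega> * iexp (\<Sum>i\<in>insert j I. (if i = j then t else a i) * V i \<omega>)" for \<omega>
        using insert.hyps by (simp add: distrib_left exp_add del: of_real_sum)
      then show "(CLINT \<omega>|M. ?W \<omega> * iexp (t * V j \<omega>)) = 0"
        using insert.prems(4)[of "\<lambda>i. if i = j then t else a i"] by (simp only:)
    qed auto
    then show "(CLINT \<omega>|M. ?U \<omega> * iexp (\<Sum>i\<in>I. a i * V i \<omega>)) = 0"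
      by (simp add: ac_simps)
  qed (use insert.prems in auto)
  then show ?case using insert.hyps by (simp add: ac_simps)
qed

text \<open>Two passes turn exponentials into indicators, first along \<open>V\<close> and then
  along \<open>Z\<close>, each with a centred weight whose transform vanishes by factorization. This
  gives the product rule for boxes, and uniqueness of measures extends it to all measurable sets of
  tuples.\<close>

lemma (in prob_space) indep_var_of_char_factor:
  fixes Z :: "'a \<Rightarrow> real" and V :: "'i \<Rightarrow> 'a \<Rightarrow> real"
  assumes fin: "finite I" and Z [measurable]: "Z \<in> borel_measurable M"
    and V [measurable]: "\<And>i. i \<in> I \<Longrightarrow> V i \<in> borel_measurable M"
    and ch: "\<And>t a. (CLINT \<omega>|M. iexp (t * Z \<omega> + (\<Sum>i\<in>I. a i * V i \<omega>)))
      = (CLINT \<omega>|M. iexp (t * Z \<omega>)) * (CLINT \<omega>|M. iexp (\<Sum>i\<in>I. a i * V i \<omega>))"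
    and g [measurable]: "g \<in> borel_measurable (\<Pi>\<^sub>M i\<in>I. borel)"
  shows "indep_var borel Z borel (\<lambda>\<omega>. g (\<lambda>i\<in>I. V i \<omega>) :: real)"
proof -
  let ?V = "\<lambda>\<omega>. \<lambda>i\<in>I. V i \<omega>"
  have mV [measurable]: "?V \<in> measurable M (\<Pi>\<^sub>M i\<in>I. borel)"
    by measurable
  have int1: "integrable M (\<lambda>\<omega>. iexp (f \<omega>))" if "f \<in> borel_measurable M" for f
    using integrable_iexp[of "\<lambda>x. complex_of_real (f x)"] that by simp
  have box: "prob {\<omega> \<in> space M. Z \<omega> \<in> A \<and> (\<forall>i\<in>I. V i \<omega> \<in> B i)}
      = prob {\<omega> \<in> space M. Z \<omega> \<in> A} * prob {\<omega> \<in> space M. \<forall>i\<in>I. V i \<omega> \<in> B i}"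
    if A [measurable]: "A \<in> sets borel" and B [measurable]: "\<And>i. i \<in> I \<Longrightarrow> B i \<in> sets borel" for A B
  proof -
    define b where "b \<omega> = (\<Prod>i\<in>I. indicator (B i) (V i \<omega>) :: real)" for \<omega>
    define q where "q = (\<integral>\<omega>. b \<omega> \<partial>M)"
    have b: "b \<omega> = of_bool (\<forall>i\<in>I. V i \<omega> \<in> B i)" for \<omega>
      unfolding b_def using fin by (auto simp: indicator_def prod_zero_iff)
    have [measurable]: "b \<in> borel_measurable M" unfolding b_def by measurable
    have intb: "integrable M b" by (rule integrable_const_bound[of _ 1]) (auto simp: b)
    have bc: "complex_of_real (b \<omega>) = (\<Prod>i\<in>I. indicator (B i) (V i \<omega>))" for \<omega>
      unfolding b_def of_real_prod by (rule prod.cong) (auto simp: indicator_def)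
    \<comment> \<open>Second pass: the weight is the centred box indicator, and its transform along
      \<open>Z\<close> vanishes by the first pass, carried out inside.\<close>
    have "(CLINT \<omega>|M. complex_of_real (b \<omega> - q) * indicator A (Z \<omega>)) = 0"
    proof (rule expectation_indicator_eq_0)
      show "integrable M (\<lambda>\<omega>. complex_of_real (b \<omega> - q))" using intb by auto
      fix t
      let ?k = "CLINT \<omega>|M. iexp (t * Z \<omega>)"
      \<comment> \<open>First pass: by \<open>ch\<close>, the centred exponential of
        \<open>Z\<close> is orthogonal to every exponential in \<open>V\<close>, hence to every box
        indicator.\<close>
      have "(CLINT \<omega>|M. (iexp (t * Z \<omega>) - ?k) * (\<Prod>i\<in>I. indicator (B i) (V i \<omega>))) = 0"
      proof (rule expectation_box_eq_0[OF fin])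
        show "integrable M (\<lambda>\<omega>. iexp (t * Z \<omega>) - ?k)"
          by (intro Bochner_Integration.integrable_diff int1) auto
        fix a
        have "(CLINT \<omega>|M. (iexp (t * Z \<omega>) - ?k) * iexp (\<Sum>i\<in>I. a i * V i \<omega>))
          = (CLINT \<omega>|M. iexp (t * Z \<omega> + (\<Sum>i\<in>I. a i * V i \<omega>)) - ?k * iexp (\<Sum>i\<in>I. a i * V i \<omega>))"
          by (simp add: left_diff_distrib distrib_left exp_add del: of_real_sum)
        also have "\<dots> = 0"
          by (subst Bochner_Integration.integral_diff)
             (auto simp: ch intro!: int1 integrable_mult_right simp del: of_real_sum of_real_add of_real_mult)
        finally show "(CLINT \<omega>|M. (iexp (t * Z \<omega>) - ?k) * iexp (\<Sum>i\<in>I. a i * V i \<omega>)) = 0" .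
      qed auto
      then have 1: "(CLINT \<omega>|M. (iexp (t * Z \<omega>) - ?k) * b \<omega>) = 0" by (simp only: bc)
      have ib: "integrable M (\<lambda>\<omega>. iexp (t * Z \<omega>) * b \<omega>)"
        by (rule Bochner_Integration.integrable_bound[OF intb]) (auto simp: norm_mult)
      have "(CLINT \<omega>|M. iexp (t * Z \<omega>) * b \<omega>) = ?k * q"
        using 1 ib intb by (simp add: left_diff_distrib q_def)
      moreover have "integrable M (\<lambda>\<omega>. iexp (t * Z \<omega>) * q)"
        by (intro integrable_mult_left int1) auto
      ultimately show "(CLINT \<omega>|M. complex_of_real (b \<omega> - q) * iexp (t * Z \<omega>)) = 0"
        using ib by (simp add: left_diff_distrib mult.commute)
    qed auto
    then have "(CLINT \<omega>|M. complex_of_real ((b \<omega> - q) * indicator A (Z \<omega>))) = 0"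
      by (simp add: indicator_def of_bool_def if_distrib cong: if_cong)
    then have 0: "(\<integral>\<omega>. (b \<omega> - q) * indicator A (Z \<omega>) \<partial>M) = 0"
      by (simp only: integral_complex_of_real of_real_eq_0_iff)
    have i1: "integrable M (\<lambda>\<omega>. b \<omega> * indicator A (Z \<omega>))"
      by (rule Bochner_Integration.integrable_bound[OF intb]) (auto simp: indicator_def)
    have i2: "integrable M (\<lambda>\<omega>. indicator A (Z \<omega>) :: real)"
      by (rule integrable_const_bound[of _ 1]) (auto simp: indicator_def)
    have "(\<integral>\<omega>. b \<omega> * indicator A (Z \<omega>) \<partial>M) = q * (\<integral>\<omega>. indicator A (Z \<omega>) \<partial>M)"
      using 0 i1 i2 by (simp add: left_diff_distrib)
    moreover have "(\<integral>\<omega>. b \<omega> * indicator A (Z \<omega>) \<partial>M)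
        = (\<integral>\<omega>. indicator {\<omega> \<in> space M. Z \<omega> \<in> A \<and> (\<forall>i\<in>I. V i \<omega> \<in> B i)} \<omega> \<partial>M)"
      by (intro Bochner_Integration.integral_cong) (auto simp: b indicator_def)
    moreover have "(\<integral>\<omega>. indicator A (Z \<omega>) \<partial>M)
        = (\<integral>\<omega>. indicator {\<omega> \<in> space M. Z \<omega> \<in> A} \<omega> \<partial>M :: real)"
      by (intro Bochner_Integration.integral_cong) (auto simp: indicator_def)
    moreover have "q = (\<integral>\<omega>. indicator {\<omega> \<in> space M. \<forall>i\<in>I. V i \<omega> \<in> B i} \<omega> \<partial>M)"
      unfolding q_def by (intro Bochner_Integration.integral_cong) (auto simp: b indicator_def)
    ultimately show ?thesis by (simp add: Int_def conj_commute conj_left_commute)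
  qed
  have gen: "prob ((Z -` A \<inter> space M) \<inter> (?V -` C \<inter> space M)) = prob (Z -` A \<inter> space M) * prob (?V -` C \<inter> space M)"
    if A [measurable]: "A \<in> sets borel" and C: "C \<in> sets (\<Pi>\<^sub>M i\<in>I. borel :: real measure)" for A C
  proof -
    \<comment> \<open>\<open>P\<close> is the law of the tuple restricted to the event that
      \<open>Z\<close> lies in \<open>A\<close>; \<open>Q\<close> is its full law scaled by the
      probability of that event. Boxes form an intersection-stable generator, so agreement there
      gives \<open>P = Q\<close>.\<close>
    define P where "P = distr (density M (indicator (Z -` A \<inter> space M))) (\<Pi>\<^sub>M i\<in>I. borel) ?V"
    define Q where "Q = scale_measure (prob (Z -` A \<inter> space M)) (distr M (\<Pi>\<^sub>M i\<in>I. borel) ?V)"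
    have ZA [measurable]: "Z -` A \<inter> space M \<in> sets M" by measurable
    have P: "emeasure P C = prob ((Z -` A \<inter> space M) \<inter> (?V -` C \<inter> space M))"
      if C: "C \<in> sets (\<Pi>\<^sub>M i\<in>I. borel :: real measure)" for C
    proof -
      have "?V -` C \<inter> space M \<in> sets M" using C by measurable
      then show ?thesis using C
        by (simp add: P_def emeasure_distr emeasure_restricted emeasure_eq_measure)
    qed
    have Q: "emeasure Q C = prob (Z -` A \<inter> space M) * prob (?V -` C \<inter> space M)"
      if C: "C \<in> sets (\<Pi>\<^sub>M i\<in>I. borel :: real measure)" for C
      using C by (simp add: Q_def emeasure_distr emeasure_eq_measure ennreal_mult)
    have "P = Q"
    proof (rule measure_eqI_PiM_finite[OF fin])
      fix B :: "'i \<Rightarrow> real set" assume B: "\<And>i. i \<in> I \<Longrightarrow> B i \<in> sets borel"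
      then have BI: "Pi\<^sub>E I B \<in> sets (\<Pi>\<^sub>M i\<in>I. borel)" by (intro sets_PiM_I_finite fin)
      have e: "?V -` Pi\<^sub>E I B \<inter> space M = {\<omega> \<in> space M. \<forall>i\<in>I. V i \<omega> \<in> B i}"
        by (auto simp: PiE_iff)
      have e2: "Z -` A \<inter> space M = {\<omega> \<in> space M. Z \<omega> \<in> A}" by auto
      have e3: "(Z -` A \<inter> space M) \<inter> (?V -` Pi\<^sub>E I B \<inter> space M) = {\<omega> \<in> space M. Z \<omega> \<in> A \<and> (\<forall>i\<in>I. V i \<omega> \<in> B i)}"
        by (auto simp: PiE_iff)
      show "emeasure P (Pi\<^sub>E I B) = emeasure Q (Pi\<^sub>E I B)"
        unfolding P[OF BI] Q[OF BI] e3 unfolding e e2 using box[of A B] A B by simp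
    next
      show "range (\<lambda>_::nat. \<Pi>\<^sub>E i\<in>I. UNIV) \<subseteq> prod_algebra I (\<lambda>_. borel :: real measure)"
        using fin by (auto intro!: prod_algebraI_finite)
      show "(\<Union>_::nat. \<Pi>\<^sub>E i\<in>I. UNIV) = space (\<Pi>\<^sub>M i\<in>I. borel :: real measure)"
        by (simp add: space_PiM)
      show "emeasure P (\<Pi>\<^sub>E i\<in>I. UNIV) \<noteq> \<infinity>"
        by (subst P) (auto intro!: sets_PiM_I_finite fin)
    qed (auto simp: P_def Q_def)
    then show ?thesis using P[OF C] Q[OF C] by simp
  qed
  let ?G = "\<lambda>\<omega>. g (?V \<omega>)"
  have mG [measurable]: "?G \<in> borel_measurable M" by (rule measurable_compose[OF mV g])
  have gG: "prob ((Z -` A \<inter> space M) \<inter> (?G -` B \<inter> space M)) = prob (Z -` A \<inter> space M) * prob (?G -` B \<inter> space M)"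
    if A: "A \<in> sets borel" and B: "B \<in> sets borel" for A B
  proof -
    have "?G -` B \<inter> space M = ?V -` (g -` B \<inter> space (\<Pi>\<^sub>M i\<in>I. borel)) \<inter> space M"
      by (auto simp: space_PiM)
    then show ?thesis using gen[OF A measurable_sets[OF g B]] by simp
  qed
  show ?thesis unfolding indep_var_eq
  proof (intro conjI Z mG, rule indep_set_sigma_sets)
    show "indep_set {Z -` A \<inter> space M |A. A \<in> sets borel} {?G -` A \<inter> space M |A. A \<in> sets borel}"
      by (rule indep_setI) (use gG in \<open>auto intro: measurable_sets[OF Z] measurable_sets[OF mG]\<close>)
    have "Int_stable {f -` A \<inter> space M |A. A \<in> sets borel}" for f :: "'a \<Rightarrow> real"
      unfolding Int_stable_def
    proof safe
      fix A B :: "real set" assume "A \<in> sets borel" "B \<in> sets borel"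
      then show "\<exists>C. f -` A \<inter> space M \<inter> (f -` B \<inter> space M) = f -` C \<inter> space M \<and> C \<in> sets borel"
        by (intro exI[of _ "A \<inter> B"]) auto
    qed
    then show "Int_stable {Z -` A \<inter> space M |A. A \<in> sets borel}"
      and "Int_stable {?G -` A \<inter> space M |A. A \<in> sets borel}" by auto
  qed
qed

subsection \<open>Regression in jointly Gaussian families\<close>

definition square_integrable :: "'a measure \<Rightarrow> ('a \<Rightarrow> real) \<Rightarrow> bool" where
  "square_integrable M f \<longleftrightarrow> f \<in> borel_measurable M \<and> integrable M (\<lambda>\<omega>. (f \<omega>)\<^sup>2)"

lemma square_integrable_measurable: "square_integrable M f \<Longrightarrow> f \<in> borel_measurable M"
  by (simp add: square_integrable_def)

lemma square_integrable_mult: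
  assumes "square_integrable M f" "square_integrable M g"
  shows "integrable M (\<lambda>\<omega>. f \<omega> * g \<omega>)"
proof (rule Bochner_Integration.integrable_bound)
  show "integrable M (\<lambda>\<omega>. (f \<omega>)\<^sup>2 + (g \<omega>)\<^sup>2)"
    using assms by (simp add: square_integrable_def)
  show "(\<lambda>\<omega>. f \<omega> * g \<omega>) \<in> borel_measurable M"
    using assms by (auto simp: square_integrable_def)
  have "\<bar>x * y\<bar> \<le> \<bar>x\<^sup>2 + y\<^sup>2\<bar>" for x y :: real
    using sum_squares_bound[of x y] sum_squares_bound[of x "- y"]
    by (simp add: abs_le_iff)
  then show "AE \<omega> in M. norm (f \<omega> * g \<omega>) \<le> norm ((f \<omega>)\<^sup>2 + (g \<omega>)\<^sup>2)"
    by simp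
qed

lemma square_integrable_scale:
  "square_integrable M f \<Longrightarrow> square_integrable M (\<lambda>\<omega>. c * f \<omega>)"
  by (auto simp: square_integrable_def power_mult_distrib)

lemma square_integrable_add:
  assumes "square_integrable M f" "square_integrable M g"
  shows "square_integrable M (\<lambda>\<omega>. f \<omega> + g \<omega>)"
  using assms square_integrable_mult[OF assms]
  by (auto simp: square_integrable_def power2_sum mult.assoc)

lemma square_integrable_diff:
  assumes "square_integrable M f" "square_integrable M g"
  shows "square_integrable M (\<lambda>\<omega>. f \<omega> - g \<omega>)"
  using square_integrable_add[OF assms(1) square_integrable_scale[OF assms(2), of "- 1"]] by simp

lemma square_integrable_lincomb:
  assumes "finite J" "\<And>j. j \<in> J \<Longrightarrow> square_integrable M (X j)"
  shows "square_integrable M (\<lambda>\<omega>. \<Sum>j\<in>J. a j * X j \<omega>)"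
  using assms
proof (induction J rule: finite_induct)
  case empty
  then show ?case by (simp add: square_integrable_def)
next
  case (insert x F)
  then show ?case by (auto intro!: square_integrable_add square_integrable_scale)
qed

lemma integral_mult_lincomb:
  assumes "finite J" "\<And>j. j \<in> J \<Longrightarrow> square_integrable M (X j)" "square_integrable M Z"
  shows "(\<integral>\<omega>. Z \<omega> * (\<Sum>j\<in>J. a j * X j \<omega>) \<partial>M) = (\<Sum>j\<in>J. a j * (\<integral>\<omega>. Z \<omega> * X j \<omega> \<partial>M))"
proof -
  have "(\<integral>\<omega>. Z \<omega> * (\<Sum>j\<in>J. a j * X j \<omega>) \<partial>M) = (\<integral>\<omega>. (\<Sum>j\<in>J. a j * (Z \<omega> * X j \<omega>)) \<partial>M)"
    by (simp add: sum_distrib_left ac_simps)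
  also have "\<dots> = (\<Sum>j\<in>J. a j * (\<integral>\<omega>. Z \<omega> * X j \<omega> \<partial>M))"
    using assms by (subst Bochner_Integration.integral_sum) (auto intro!: square_integrable_mult)
  finally show ?thesis .
qed

text \<open>This is Gram-Schmidt: \<open>D\<close> is the residual of the new vector
  \<open>X x\<close> over \<open>F\<close>, and the residual \<open>Z\<close> of \<open>W\<close>
  over \<open>F\<close> is corrected by its projection onto \<open>D\<close>. No Gram matrix has to
  be inverted.\<close>

lemma ex_orthogonal_residual:
  assumes "finite J" "\<And>j. j \<in> J \<Longrightarrow> square_integrable M (X j)" "square_integrable M W"
  shows "\<exists>a. \<forall>k\<in>J. (\<integral>\<omega>. (W \<omega> - (\<Sum>j\<in>J. a j * X j \<omega>)) * X k \<omega> \<partial>M) = 0"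
  using assms
proof (induction J arbitrary: W rule: finite_induct)
  case empty
  then show ?case by simp
next
  case (insert x F)
  have X: "square_integrable M (X j)" if "j \<in> F" for j using insert.prems(1) that by simp
  have Xx: "square_integrable M (X x)" using insert.prems(1) by simp
  obtain a where a: "\<forall>k\<in>F. (\<integral>\<omega>. (W \<omega> - (\<Sum>j\<in>F. a j * X j \<omega>)) * X k \<omega> \<partial>M) = 0"
    using insert.IH[OF X insert.prems(2)] by auto
  obtain d where d: "\<forall>k\<in>F. (\<integral>\<omega>. (X x \<omega> - (\<Sum>j\<in>F. d j * X j \<omega>)) * X k \<omega> \<partial>M) = 0"
    using insert.IH[OF X Xx] by auto
  define Z where "Z \<omega> = W \<omega> - (\<Sum>j\<in>F. a j * X j \<omega>)" for \<omega>
  define D where "D \<omega> = X x \<omega> - (\<Sum>j\<in>F. d j * X j \<omega>)" for \<omega>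
  define c where "c = (\<integral>\<omega>. Z \<omega> * D \<omega> \<partial>M) / (\<integral>\<omega>. D \<omega> * D \<omega> \<partial>M)"
  have sZ: "square_integrable M Z" and sD: "square_integrable M D"
    unfolding Z_def D_def using insert.hyps insert.prems X Xx
    by (auto intro!: square_integrable_diff square_integrable_lincomb)
  have c: "(\<integral>\<omega>. Z \<omega> * D \<omega> \<partial>M) = c * (\<integral>\<omega>. D \<omega> * D \<omega> \<partial>M)"
  proof (cases "(\<integral>\<omega>. D \<omega> * D \<omega> \<partial>M) = 0")
    case True
    then have "AE \<omega> in M. D \<omega> * D \<omega> = 0"
      using integral_nonneg_eq_0_iff_AE[OF square_integrable_mult[OF sD sD]] by simp
    then have "AE \<omega> in M. Z \<omega> * D \<omega> = 0" by eventually_elim simp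
    then show ?thesis using True by (simp add: integral_eq_zero_AE)
  qed (simp add: c_def)
  define Z' where "Z' \<omega> = Z \<omega> - c * D \<omega>" for \<omega>
  have sZ': "square_integrable M Z'" unfolding Z'_def
    by (intro square_integrable_diff sZ square_integrable_scale sD)
  have lin: "(\<integral>\<omega>. Z' \<omega> * g \<omega> \<partial>M) = (\<integral>\<omega>. Z \<omega> * g \<omega> \<partial>M) - c * (\<integral>\<omega>. D \<omega> * g \<omega> \<partial>M)"
    if "square_integrable M g" for g
    using square_integrable_mult[OF sZ that] square_integrable_mult[OF sD that]
    by (simp add: Z'_def left_diff_distrib mult.assoc)
  have F0: "(\<integral>\<omega>. Z' \<omega> * X k \<omega> \<partial>M) = 0" if "k \<in> F" for k
    using a d that lin[OF X[OF that]] by (simp add: Z_def D_def)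
  \<comment> \<open>Orthogonality to \<open>X x\<close> follows from orthogonality to
    \<open>D\<close> and to the variables over \<open>F\<close>, of which \<open>X x\<close> is a
    combination.\<close>
  have Xx_eq: "X x = (\<lambda>\<omega>. D \<omega> + (\<Sum>j\<in>F. d j * X j \<omega>))" by (simp add: D_def)
  have "(\<integral>\<omega>. Z' \<omega> * X x \<omega> \<partial>M) = (\<integral>\<omega>. Z' \<omega> * D \<omega> + Z' \<omega> * (\<Sum>j\<in>F. d j * X j \<omega>) \<partial>M)"
    by (subst Xx_eq) (simp add: distrib_left)
  also have "\<dots> = (\<integral>\<omega>. Z' \<omega> * D \<omega> \<partial>M) + (\<integral>\<omega>. Z' \<omega> * (\<Sum>j\<in>F. d j * X j \<omega>) \<partial>M)"
    by (intro Bochner_Integration.integral_add square_integrable_mult sZ' sD square_integrable_lincomb insert.hyps X)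
  also have "(\<integral>\<omega>. Z' \<omega> * (\<Sum>j\<in>F. d j * X j \<omega>) \<partial>M) = 0"
    using integral_mult_lincomb[OF insert.hyps(1) X sZ'] F0 by simp
  also have "(\<integral>\<omega>. Z' \<omega> * D \<omega> \<partial>M) = 0" using lin[OF sD] c by simp
  finally have x0: "(\<integral>\<omega>. Z' \<omega> * X x \<omega> \<partial>M) = 0" by simp
  \<comment> \<open>Expanding \<open>D\<close> puts the coefficient \<open>c\<close> on
    \<open>X x\<close> and shifts those over \<open>F\<close> by \<open>- c * d j\<close>.\<close>
  define b where "b j = (if j = x then c else a j - c * d j)" for j
  have "W \<omega> - (\<Sum>j\<in>insert x F. b j * X j \<omega>) = Z' \<omega>" for \<omega>
  proof -
    have "(\<Sum>j\<in>F. b j * X j \<omega>) = (\<Sum>j\<in>F. a j * X j \<omega> - c * (d j * X j \<omega>))"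
      using insert.hyps by (intro sum.cong) (auto simp: b_def algebra_simps)
    also have "\<dots> = (\<Sum>j\<in>F. a j * X j \<omega>) - c * (\<Sum>j\<in>F. d j * X j \<omega>)"
      by (simp add: sum_subtractf sum_distrib_left)
    finally show ?thesis using insert.hyps
      by (simp add: Z'_def Z_def D_def b_def algebra_simps)
  qed
  then show ?case using F0 x0 by (intro exI[of _ b]) auto
qed

section \<open>Centred Gaussian variables\<close>

context prob_space
begin

text \<open>Both alternatives of \<open>gaussian_rv\<close> become a scaled standard normal law,
  with scale 0 for the degenerate one; centring forces \<open>\<mu> = 0\<close> in either
  case.\<close>

lemma gaussian_rv_distr:
  assumes G: "gaussian_rv M Y" and E: "expectation Y = 0"
  shows "\<exists>s\<ge>0. distr M borel Y = distr std_normal_distribution borel (\<lambda>x. s * x)"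
  using G unfolding gaussian_rv_def
proof (elim disjE exE conjE)
  fix \<mu> s :: real
  assume s: "0 < s" and D: "distributed M lborel Y (normal_density \<mu> s)"
  interpret S: real_distribution std_normal_distribution by (rule real_dist_normal_dist)
  have "\<mu> = 0" using normal_distributed_expectation[OF s D] E by simp
  have "distributed std_normal_distribution lborel (\<lambda>x. x) std_normal_density"
    by (auto simp: distributed_def distr_id2)
  from S.normal_density_affine[OF this, of s 0]
  have "distributed std_normal_distribution lborel (\<lambda>x. s * x) (normal_density 0 s)"
    using s by simp
  then have "distr M lborel Y = distr std_normal_distribution lborel (\<lambda>x. s * x)"
    using D \<open>\<mu> = 0\<close> by (simp add: distributed_def)
  moreover have "distr M lborel Y = distr M borel Y"
    "distr std_normal_distribution lborel (\<lambda>x. s * x) = distr std_normal_distribution borel (\<lambda>x. s * x)"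
    by (auto intro!: distr_cong)
  ultimately show ?thesis using s by (intro exI[of _ s]) simp
next
  fix \<mu> :: real
  assume [measurable]: "Y \<in> borel_measurable M" and ae: "AE \<omega> in M. Y \<omega> = \<mu>"
  interpret S: real_distribution std_normal_distribution by (rule real_dist_normal_dist)
  have "expectation Y = expectation (\<lambda>_. \<mu>)" using ae by (intro integral_cong_AE) auto
  then have "\<mu> = 0" using E by (simp add: prob_space)
  have "distr M borel Y = distr M borel (\<lambda>_. 0)"
    using ae \<open>\<mu> = 0\<close> by (intro distr_cong_AE) auto
  also have "\<dots> = return borel 0" by (intro distr_const) simp
  also have "\<dots> = distr std_normal_distribution borel (\<lambda>x. 0 * x)"
    by (simp add: S.distr_const)
  finally show ?thesis by (intro exI[of _ 0]) simp
qed

lemma gaussian_rv_measurable: "gaussian_rv M Y \<Longrightarrow> Y \<in> borel_measurable M"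
  by (auto simp: gaussian_rv_def distributed_def)

context
  fixes Y assumes Y: "gaussian_rv M Y" "expectation Y = 0"
begin

text \<open>The unknown scale is recovered from the second moment, so the variance alone determines
  the law.\<close>

lemma centered_gaussian_moments:
  "square_integrable M Y \<and>
    distr M borel Y = distr std_normal_distribution borel (\<lambda>x. sqrt (expectation (\<lambda>\<omega>. (Y \<omega>)\<^sup>2)) * x)"
proof -
  have [measurable]: "Y \<in> borel_measurable M" by (rule gaussian_rv_measurable[OF Y(1)])
  obtain s where s: "0 \<le> s" and D: "distr M borel Y = distr std_normal_distribution borel (\<lambda>x. s * x)"
    using gaussian_rv_distr[OF Y] by auto
  have "integrable (distr M borel Y) (\<lambda>x. x\<^sup>2)" unfolding D
    by (subst integrable_distr_eq) (auto simp: power_mult_distrib integrable_std_normal_distribution_moment)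
  then have int: "integrable M (\<lambda>\<omega>. (Y \<omega>)\<^sup>2)" by (subst (asm) integrable_distr_eq) auto
  have "expectation (\<lambda>\<omega>. (Y \<omega>)\<^sup>2) = (\<integral>x. x\<^sup>2 \<partial>distr M borel Y)" by (subst integral_distr) auto
  also have "\<dots> = s\<^sup>2" unfolding D using std_normal_distribution_even_moments(1)[of 1]
    by (subst integral_distr) (auto simp: power_mult_distrib)
  finally have "sqrt (expectation (\<lambda>\<omega>. (Y \<omega>)\<^sup>2)) = s" using s by simp
  with int D show ?thesis by (simp add: square_integrable_def)
qed

lemma centered_gaussian_iexp:
  "(CLINT \<omega>|M. iexp (Y \<omega>)) = exp (- (expectation (\<lambda>\<omega>. (Y \<omega>)\<^sup>2)) / 2)"
proof -
  have [measurable]: "Y \<in> borel_measurable M" by (rule gaussian_rv_measurable[OF Y(1)])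
  define s where "s = sqrt (expectation (\<lambda>\<omega>. (Y \<omega>)\<^sup>2))"
  have s2: "s\<^sup>2 = expectation (\<lambda>\<omega>. (Y \<omega>)\<^sup>2)" unfolding s_def by simp
  have "(CLINT \<omega>|M. iexp (Y \<omega>)) = (CLINT x|distr M borel Y. iexp x)"
    by (subst integral_distr) auto
  also have "\<dots> = char std_normal_distribution s"
    unfolding centered_gaussian_moments[THEN conjunct2] s_def[symmetric] char_def
    by (subst integral_distr) auto
  finally show ?thesis by (simp add: char_std_normal_distribution s2)
qed

lemma prob_centered_gaussian_less:
  assumes "y \<le> sqrt (expectation (\<lambda>\<omega>. (Y \<omega>)\<^sup>2)) * b"
  shows "prob {\<omega> \<in> space M. Y \<omega> < y} \<le> std_normal_cdf b"
proof -
  interpret S: real_distribution std_normal_distribution by (rule real_dist_normal_dist)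
  have [measurable]: "Y \<in> borel_measurable M" by (rule gaussian_rv_measurable[OF Y(1)])
  define s where "s = sqrt (expectation (\<lambda>\<omega>. (Y \<omega>)\<^sup>2))"
  have "prob {\<omega> \<in> space M. Y \<omega> < y} = measure (distr M borel Y) {..<y}"
    by (subst measure_distr) (auto intro!: arg_cong[where f=prob])
  also have "\<dots> = measure std_normal_distribution {x. s * x < y}"
    unfolding centered_gaussian_moments[THEN conjunct2] s_def[symmetric]
    by (subst measure_distr) (auto intro!: arg_cong[where f="measure std_normal_distribution"])
  also have "\<dots> \<le> measure std_normal_distribution {..<b}"
  proof (rule S.finite_measure_mono)
    \<comment> \<open>Avoiding division by \<open>s\<close> covers \<open>s = 0\<close>: then
      \<open>y \<le> 0\<close> and the event is empty.\<close>
    have "x < b" if "s * x < y" for x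
    proof (rule ccontr)
      assume "\<not> x < b"
      then have "s * b \<le> s * x" by (intro mult_left_mono) (auto simp: s_def)
      then show False using that assms by (simp add: s_def)
    qed
    then show "{x. s * x < y} \<subseteq> {..<b}" by auto
  qed simp
  finally show ?thesis by (simp add: measure_std_normal_less)
qed

end

section \<open>Linear combinations and regression of jointly Gaussian variables\<close>

lemma jointly_gaussianD:
  "jointly_gaussian M I X \<Longrightarrow> gaussian_rv M (\<lambda>\<omega>. \<Sum>i\<in>I. a i * X i \<omega>)"
  by (simp add: jointly_gaussian_def)

lemma jointly_gaussian_subset:
  assumes "jointly_gaussian M I X" "finite I" "J \<subseteq> I"
  shows "jointly_gaussian M J X"
  unfolding jointly_gaussian_def
proof (intro conjI allI ballI)
  fix a
  have "(\<Sum>i\<in>I. (if i \<in> J then a i else 0) * X i \<omega>) = (\<Sum>i\<in>J. a i * X i \<omega>)" for \<omega>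
    using assms by (intro sum.mono_neutral_cong_right) auto
  moreover have "gaussian_rv M (\<lambda>\<omega>. \<Sum>i\<in>I. (if i \<in> J then a i else 0) * X i \<omega>)"
    by (rule jointly_gaussianD[OF assms(1)])
  ultimately show "gaussian_rv M (\<lambda>\<omega>. \<Sum>i\<in>J. a i * X i \<omega>)" by simp
qed (use assms in \<open>auto simp: jointly_gaussian_def\<close>)

lemma integrable_of_square_integrable: "square_integrable M f \<Longrightarrow> integrable M f"
  using square_integrable_mult[of M f "\<lambda>_. 1"] by (simp add: square_integrable_def)

lemma jointly_gaussian_square_integrable:
  assumes "jointly_gaussian M I X" "finite I" "k \<in> I" "expectation (X k) = 0"
  shows "square_integrable M (X k)"
proof -
  have "jointly_gaussian M {k} X" using jointly_gaussian_subset[OF assms(1)] assms by auto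
  then have "gaussian_rv M (\<lambda>\<omega>. \<Sum>j\<in>{k}. 1 * X j \<omega>)" by (rule jointly_gaussianD)
  then have "gaussian_rv M (X k)" by simp
  then show ?thesis using centered_gaussian_moments assms(4) by blast
qed

lemma jointly_gaussian_lincomb:
  assumes "jointly_gaussian M I X" "finite I" "J \<subseteq> I" "\<And>k. k \<in> J \<Longrightarrow> expectation (X k) = 0"
  shows "gaussian_rv M (\<lambda>\<omega>. \<Sum>j\<in>J. a j * X j \<omega>)" "expectation (\<lambda>\<omega>. \<Sum>j\<in>J. a j * X j \<omega>) = 0"
proof -
  show "gaussian_rv M (\<lambda>\<omega>. \<Sum>j\<in>J. a j * X j \<omega>)"
    by (rule jointly_gaussianD[OF jointly_gaussian_subset[OF assms(1-3)]])
  have "integrable M (X k)" if "k \<in> J" for k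
    using that assms by (intro integrable_of_square_integrable jointly_gaussian_square_integrable[OF assms(1)]) auto
  then show "expectation (\<lambda>\<omega>. \<Sum>j\<in>J. a j * X j \<omega>) = 0"
    using assms(4) by (subst Bochner_Integration.integral_sum) auto
qed

text \<open>The orthogonal residual \<open>Z\<close> has no cross term with combinations of the
  \<open>X j\<close>, so variances add. Every combination is centred Gaussian with characteristic
  function \<open>exp (- variance / 2)\<close>, so additivity of variances is factorization, and
  this yields independence.\<close>

lemma jointly_gaussian_regression:
  assumes J: "finite J" "i \<notin> J" and G: "jointly_gaussian M (insert i J) X"
    and mean: "\<And>k. k \<in> insert i J \<Longrightarrow> expectation (X k) = 0"
  shows "\<exists>a. \<forall>g\<in>borel_measurable (\<Pi>\<^sub>M j\<in>J. borel).
    indep_var borel (\<lambda>\<omega>. X i \<omega> - (\<Sum>j\<in>J. a j * X j \<omega>)) borel (\<lambda>\<omega>. g (\<lambda>j\<in>J. X j \<omega>) :: real)"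
proof -
  have meas [measurable]: "X k \<in> borel_measurable M" if "k \<in> insert i J" for k
    using G that unfolding jointly_gaussian_def by blast
  have sq: "square_integrable M (X k)" if "k \<in> insert i J" for k
    using jointly_gaussian_square_integrable[OF G _ that mean[OF that]] J by simp
  obtain a where a: "\<forall>k\<in>J. (\<integral>\<omega>. (X i \<omega> - (\<Sum>j\<in>J. a j * X j \<omega>)) * X k \<omega> \<partial>M) = 0"
    using ex_orthogonal_residual[OF J(1), of M X "X i"] sq by auto
  define Z where "Z \<omega> = X i \<omega> - (\<Sum>j\<in>J. a j * X j \<omega>)" for \<omega>
  have sZ: "square_integrable M Z" unfolding Z_def
    using sq J by (auto intro!: square_integrable_diff square_integrable_lincomb)
  note [measurable] = square_integrable_measurable[OF sZ]
  have comb: "gaussian_rv M (\<lambda>\<omega>. t * Z \<omega> + (\<Sum>j\<in>J. b j * X j \<omega>))"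
    "expectation (\<lambda>\<omega>. t * Z \<omega> + (\<Sum>j\<in>J. b j * X j \<omega>)) = 0" for t b
  proof -
    let ?c = "\<lambda>k. if k = i then t else b k - t * a k"
    have "(\<Sum>j\<in>J. ?c j * X j \<omega>) = (\<Sum>j\<in>J. b j * X j \<omega> - t * (a j * X j \<omega>))" for \<omega>
      using J by (intro sum.cong) (auto simp: algebra_simps)
    then have eq: "(\<Sum>j\<in>insert i J. ?c j * X j \<omega>) = t * Z \<omega> + (\<Sum>j\<in>J. b j * X j \<omega>)" for \<omega>
      using J by (simp add: Z_def right_diff_distrib sum_subtractf sum_distrib_left)
    show "gaussian_rv M (\<lambda>\<omega>. t * Z \<omega> + (\<Sum>j\<in>J. b j * X j \<omega>))"
      "expectation (\<lambda>\<omega>. t * Z \<omega> + (\<Sum>j\<in>J. b j * X j \<omega>)) = 0"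
      using jointly_gaussian_lincomb[OF G _ order_refl mean, of ?c] J unfolding eq by auto
  qed
  have var: "expectation (\<lambda>\<omega>. (t * Z \<omega> + (\<Sum>j\<in>J. b j * X j \<omega>))\<^sup>2)
      = t\<^sup>2 * expectation (\<lambda>\<omega>. (Z \<omega>)\<^sup>2) + expectation (\<lambda>\<omega>. (\<Sum>j\<in>J. b j * X j \<omega>)\<^sup>2)" for t b
  proof -
    define W where "W \<omega> = (\<Sum>j\<in>J. b j * X j \<omega>)" for \<omega>
    have sW: "square_integrable M W" unfolding W_def using J sq by (intro square_integrable_lincomb) auto
    have ZW: "(\<integral>\<omega>. Z \<omega> * W \<omega> \<partial>M) = 0"
      unfolding W_def using a J sq integral_mult_lincomb[OF J(1) _ sZ, of X b] by (simp add: Z_def)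
    have "expectation (\<lambda>\<omega>. (t * Z \<omega> + W \<omega>)\<^sup>2)
        = expectation (\<lambda>\<omega>. t\<^sup>2 * (Z \<omega>)\<^sup>2 + (W \<omega>)\<^sup>2 + 2 * t * (Z \<omega> * W \<omega>))"
      by (simp add: power2_sum power_mult_distrib ac_simps)
    also have "\<dots> = t\<^sup>2 * expectation (\<lambda>\<omega>. (Z \<omega>)\<^sup>2) + expectation (\<lambda>\<omega>. (W \<omega>)\<^sup>2)"
      using sZ sW square_integrable_mult[OF sZ sW] ZW by (simp add: square_integrable_def)
    finally show ?thesis by (simp add: W_def)
  qed
  have "indep_var borel Z borel (\<lambda>\<omega>. g (\<lambda>j\<in>J. X j \<omega>) :: real)"
    if g: "g \<in> borel_measurable (\<Pi>\<^sub>M j\<in>J. borel)" for g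
  proof (rule indep_var_of_char_factor[OF J(1) _ _ _ g])
    fix t :: real and b
    have 1: "(CLINT \<omega>|M. iexp (t * Z \<omega> + (\<Sum>j\<in>J. b j * X j \<omega>)))
        = exp (- expectation (\<lambda>\<omega>. (t * Z \<omega> + (\<Sum>j\<in>J. b j * X j \<omega>))\<^sup>2) / 2)"
      by (rule centered_gaussian_iexp[OF comb])
    have 2: "(CLINT \<omega>|M. iexp (t * Z \<omega>)) = exp (- (t\<^sup>2 * expectation (\<lambda>\<omega>. (Z \<omega>)\<^sup>2)) / 2)"
      using centered_gaussian_iexp[OF comb, of t "\<lambda>_. 0"] by (simp add: power_mult_distrib)
    have 3: "(CLINT \<omega>|M. iexp (\<Sum>j\<in>J. b j * X j \<omega>)) = exp (- expectation (\<lambda>\<omega>. (\<Sum>j\<in>J. b j * X j \<omega>)\<^sup>2) / 2)"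
      using centered_gaussian_iexp[OF comb, of 0 b] by simp
    show "(CLINT \<omega>|M. iexp (t * Z \<omega> + (\<Sum>j\<in>J. b j * X j \<omega>)))
        = (CLINT \<omega>|M. iexp (t * Z \<omega>)) * (CLINT \<omega>|M. iexp (\<Sum>j\<in>J. b j * X j \<omega>))"
      unfolding 1 2 3 var by (simp add: add_divide_distrib diff_divide_distrib flip: exp_add of_real_mult)
  qed auto
  then show ?thesis unfolding Z_def by blast
qed

end

subsection \<open>The first passage above the threshold\<close>

context prob_space
begin

section \<open>The predictor as a linear regression on the past\<close>

lemma subalgebra_past_algebra:
  assumes "\<And>j. j \<in> {1..<i} \<Longrightarrow> X j \<in> borel_measurable M"
  shows "subalgebra M (past_algebra M X i)"
proof -
  let ?V = "\<lambda>\<omega>. \<lambda>j\<in>{1..<i}. X j \<omega>"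
  have V: "?V \<in> measurable M (\<Pi>\<^sub>M j\<in>{1..<i}. borel)"
    using assms by (intro measurable_restrict) auto
  then have "?V \<in> space M \<rightarrow> space (\<Pi>\<^sub>M j\<in>{1..<i}. borel :: real measure)"
    by (auto dest: measurable_space)
  then show ?thesis
    unfolding subalgebra_def past_algebra_def
    by (auto simp: sets_vimage_algebra2 intro: measurable_sets[OF V] simp del: One_nat_def)
qed

text \<open>The regression \<open>Y\<close> is measurable for the past, and the residual is centred
  and independent of it, so the residual integrates to 0 over every past event. These properties
  characterize the conditional expectation, though only almost everywhere.\<close>

lemma gaussian_predictor:
  assumes i: "1 \<le> i" and G: "jointly_gaussian M {1..i} X"
    and mean: "\<And>k. k \<in> {1..i} \<Longrightarrow> expectation (X k) = 0"
  shows "\<exists>a. (AE \<omega> in M. predictor M X i \<omega> = (\<Sum>j\<in>{1..<i}. a j * X j \<omega>)) \<and>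
    (\<forall>g\<in>borel_measurable (\<Pi>\<^sub>M j\<in>{1..<i}. borel).
      indep_var borel (\<lambda>\<omega>. X i \<omega> - (\<Sum>j\<in>{1..<i}. a j * X j \<omega>)) borel (\<lambda>\<omega>. g (\<lambda>j\<in>{1..<i}. X j \<omega>) :: real))"
proof -
  let ?J = "{1..<i}" let ?P = "\<Pi>\<^sub>M j\<in>{1..<i}. (borel :: real measure)"
  let ?V = "\<lambda>\<omega>. \<lambda>j\<in>{1..<i}. X j \<omega>"
  have J: "insert i ?J = {1..i}" using i by auto
  obtain a where ind: "\<forall>g\<in>borel_measurable ?P.
      indep_var borel (\<lambda>\<omega>. X i \<omega> - (\<Sum>j\<in>?J. a j * X j \<omega>)) borel (\<lambda>\<omega>. g (?V \<omega>) :: real)"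
  proof -
    have G': "jointly_gaussian M (insert i ?J) X" unfolding J by (rule G)
    have "\<And>k. k \<in> insert i ?J \<Longrightarrow> expectation (X k) = 0" unfolding J by (rule mean)
    from jointly_gaussian_regression[OF _ _ G' this] that show thesis by auto
  qed
  define Y where "Y \<omega> = (\<Sum>j\<in>?J. a j * X j \<omega>)" for \<omega>
  have meas: "X k \<in> borel_measurable M" if "k \<in> {1..i}" for k
    using G that unfolding jointly_gaussian_def by blast
  then have Xi [measurable]: "X i \<in> borel_measurable M" and V [measurable]: "?V \<in> measurable M ?P"
    using i by (auto intro!: measurable_restrict)
  have int: "integrable M (X k)" if k: "k \<in> {1..i}" for k
    using jointly_gaussian_square_integrable[OF G _ k] mean[OF k] integrable_of_square_integrable by auto
  have intY: "integrable M Y" unfolding Y_def using int by auto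
  have sub: "subalgebra M (past_algebra M X i)"
    using meas by (intro subalgebra_past_algebra) auto
  interpret finite_measure_subalgebra M "past_algebra M X i"
    by unfold_locales (rule sub)
  have Vs: "?V \<in> space M \<rightarrow> space ?P" using V by (auto simp: measurable_def)
  have "AE \<omega> in M. real_cond_exp M (past_algebra M X i) (X i) \<omega> = Y \<omega>"
  proof (rule real_cond_exp_charact)
    fix A assume "A \<in> sets (past_algebra M X i)"
    \<comment> \<open>Past events are preimages under the tuple of earlier variables, so their
      indicators are functions of the tuple and independent of the residual.\<close>
    then obtain C where C: "C \<in> sets ?P" and A: "A = ?V -` C \<inter> space M"
      unfolding past_algebra_def sets_vimage_algebra2[OF Vs] by auto
    have Am [measurable]: "A \<in> sets M" unfolding A using C by measurable
    have "indep_var borel (\<lambda>\<omega>. X i \<omega> - Y \<omega>) borel (\<lambda>\<omega>. indicator C (?V \<omega>))"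
      unfolding Y_def using ind C by (auto intro: borel_measurable_indicator)
    moreover have "(\<lambda>\<omega>. indicator C (?V \<omega>) :: real) \<in> borel_measurable M"
      by (rule measurable_compose[OF V borel_measurable_indicator[OF C]])
    then have "integrable M (\<lambda>\<omega>. indicator C (?V \<omega>) :: real)"
      by (rule integrable_const_bound[of _ 1, rotated]) (simp add: indicator_def)
    moreover have "integrable M (\<lambda>\<omega>. X i \<omega> - Y \<omega>)" using int[of i] i intY by auto
    ultimately have "(\<integral>\<omega>. (X i \<omega> - Y \<omega>) * indicator C (?V \<omega>) \<partial>M)
        = expectation (\<lambda>\<omega>. X i \<omega> - Y \<omega>) * (\<integral>\<omega>. indicator C (?V \<omega>) \<partial>M)"
      by (intro indep_var_lebesgue_integral)
    also have "expectation (\<lambda>\<omega>. X i \<omega> - Y \<omega>) = 0"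
      using int i mean intY unfolding Y_def by (subst Bochner_Integration.integral_diff) (auto simp: Bochner_Integration.integral_sum)
    finally have "(\<integral>\<omega>. (X i \<omega> - Y \<omega>) * indicator C (?V \<omega>) \<partial>M) = 0"
      by (simp only: mult_zero_left)
    moreover have "indicator C (?V \<omega>) = (indicator A \<omega> :: real)" if "\<omega> \<in> space M" for \<omega>
      using that unfolding A indicator_def by simp
    then have "(\<integral>\<omega>. indicator A \<omega> * (X i \<omega> - Y \<omega>) \<partial>M) = (\<integral>\<omega>. (X i \<omega> - Y \<omega>) * indicator C (?V \<omega>) \<partial>M)"
      by (intro Bochner_Integration.integral_cong refl) (simp only: mult.commute)
    ultimately have "(\<integral>\<omega>. indicator A \<omega> * (X i \<omega> - Y \<omega>) \<partial>M) = 0" by (simp only:)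
    then have "(\<integral>\<omega>. indicator A \<omega> * X i \<omega> \<partial>M) = (\<integral>\<omega>. indicator A \<omega> * Y \<omega> \<partial>M)"
      using integrable_mult_indicator[OF Am int[of i]] integrable_mult_indicator[OF Am intY] i
      by (simp add: right_diff_distrib)
    then show "(\<integral>\<omega>\<in>A. X i \<omega> \<partial>M) = (\<integral>\<omega>\<in>A. Y \<omega> \<partial>M)"
      by (simp add: set_lebesgue_integral_def)
  next
    have "?V \<in> measurable (past_algebra M X i) ?P"
      unfolding past_algebra_def by (rule measurable_vimage_algebra1[OF Vs])
    then have "(\<lambda>\<omega>. ?V \<omega> j) \<in> borel_measurable (past_algebra M X i)" if "j \<in> ?J" for j
      using that by (rule measurable_compose[OF _ measurable_component_singleton])
    then have "X j \<in> borel_measurable (past_algebra M X i)" if "j \<in> ?J" for j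
      using that by (force cong: measurable_cong)
    then show "Y \<in> borel_measurable (past_algebra M X i)"
      unfolding Y_def by measurable
  qed (use int i intY in auto)
  then show ?thesis using ind unfolding predictor_def Y_def by blast
qed

text \<open>Independence enters only through the product rule \<open>indep\<close>: earlier survival
  and \<open>t \<le> E i \<omega>\<close> are conditions on the past, while the other factor
  concerns the innovation.\<close>

lemma prob_all_less_bound:
  fixes X E :: "nat \<Rightarrow> 'a \<Rightarrow> real"
  assumes meas: "\<And>i. i \<in> {1..n} \<Longrightarrow> X i \<in> borel_measurable M" "\<And>i. i \<in> {1..n} \<Longrightarrow> E i \<in> borel_measurable M"
    and indep: "\<And>i. i \<in> {1..n} \<Longrightarrow>
      prob {\<omega> \<in> space M. ((\<forall>j\<in>{1..<i}. X j \<omega> < r + t) \<and> t \<le> E i \<omega>) \<and> r \<le> X i \<omega> - E i \<omega>}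
      = prob {\<omega> \<in> space M. (\<forall>j\<in>{1..<i}. X j \<omega> < r + t) \<and> t \<le> E i \<omega>} * prob {\<omega> \<in> space M. r \<le> X i \<omega> - E i \<omega>}"
    and E: "\<And>i. i \<in> {1..n} \<Longrightarrow> prob {\<omega> \<in> space M. E i \<omega> < t} \<le> \<alpha>"
    and R: "\<And>i. i \<in> {1..n} \<Longrightarrow> prob {\<omega> \<in> space M. X i \<omega> - E i \<omega> < r} \<le> p"
    and p: "0 \<le> p" "p \<le> 1"
    and k: "k \<le> n"
  shows "prob {\<omega> \<in> space M. \<forall>j\<in>{1..k}. X j \<omega> < r + t} \<le> \<alpha> + p ^ k * (1 - \<alpha>)"
  using k
proof (induction k)
  case 0
  then show ?case using prob_space by simp
next
  case (Suc k)
  define i where "i = Suc k"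
  have i: "i \<in> {1..n}" "{1..<i} = {1..k}" using Suc.prems by (auto simp: i_def)
  note [measurable] = meas(1)[OF i(1)] meas(2)[OF i(1)]
  have mX [measurable]: "X j \<in> borel_measurable M" if "j \<in> {1..k}" for j
    using meas(1)[of j] that Suc.prems by auto
  define B where "B = {\<omega> \<in> space M. \<forall>j\<in>{1..k}. X j \<omega> < r + t}"
  define C where "C = {\<omega> \<in> space M. (\<forall>j\<in>{1..k}. X j \<omega> < r + t) \<and> t \<le> E i \<omega>}"
  define D where "D = {\<omega> \<in> space M. ((\<forall>j\<in>{1..k}. X j \<omega> < r + t) \<and> t \<le> E i \<omega>) \<and> r \<le> X i \<omega> - E i \<omega>}"
  define N where "N = {\<omega> \<in> space M. E i \<omega> < t}"
  have [measurable]: "B \<in> sets M" "C \<in> sets M" "D \<in> sets M" "N \<in> sets M"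
    unfolding B_def C_def D_def N_def by measurable
  \<comment> \<open>On \<open>D\<close> the inequalities for \<open>E i\<close> and for the
    innovation add up to \<open>r + t \<le> X i \<omega>\<close>, so no outcome in \<open>D\<close>
    survives step \<open>i\<close>.\<close>
  have "prob {\<omega> \<in> space M. \<forall>j\<in>{1..Suc k}. X j \<omega> < r + t} \<le> prob (B - D)"
  proof (rule finite_measure_mono)
    show "{\<omega> \<in> space M. \<forall>j\<in>{1..Suc k}. X j \<omega> < r + t} \<subseteq> B - D"
    proof
      fix \<omega> assume \<omega>: "\<omega> \<in> {\<omega> \<in> space M. \<forall>j\<in>{1..Suc k}. X j \<omega> < r + t}"
      then have "X i \<omega> < r + t" by (simp add: i_def)
      then have "\<omega> \<notin> D" by (simp add: D_def)
      then show "\<omega> \<in> B - D" using \<omega> by (simp add: B_def)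
    qed
  qed simp
  also have "\<dots> = prob B - prob D"
    by (intro finite_measure_Diff) (auto simp: B_def D_def)
  also have "prob D = prob C * prob {\<omega> \<in> space M. r \<le> X i \<omega> - E i \<omega>}"
    unfolding C_def D_def using indep[OF i(1)] by (simp only: i(2))
  finally have 1: "prob {\<omega> \<in> space M. \<forall>j\<in>{1..Suc k}. X j \<omega> < r + t}
      \<le> prob B - prob C * prob {\<omega> \<in> space M. r \<le> X i \<omega> - E i \<omega>}" .
  have "{\<omega> \<in> space M. r \<le> X i \<omega> - E i \<omega>} = space M - {\<omega> \<in> space M. X i \<omega> - E i \<omega> < r}" by auto
  then have 2: "1 - p \<le> prob {\<omega> \<in> space M. r \<le> X i \<omega> - E i \<omega>}"
    using R[OF i(1)] by (simp add: prob_compl)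
  have "prob B \<le> prob (C \<union> N)"
    by (intro finite_measure_mono) (auto simp: B_def C_def N_def)
  also have "\<dots> \<le> prob C + prob N" by (rule measure_Un_le) auto
  finally have 3: "prob B - \<alpha> \<le> prob C" using E[OF i(1)] by (simp add: N_def)
  \<comment> \<open>The left factor may be negative; as \<open>1 - p\<close> is nonnegative, the
    estimate holds all the same.\<close>
  have "(prob B - \<alpha>) * (1 - p) \<le> prob C * (1 - p)" using 3 p by (intro mult_right_mono) auto
  also have "\<dots> \<le> prob C * prob {\<omega> \<in> space M. r \<le> X i \<omega> - E i \<omega>}" using 2 by (intro mult_left_mono) auto
  finally have "prob {\<omega> \<in> space M. \<forall>j\<in>{1..Suc k}. X j \<omega> < r + t} \<le> \<alpha> + p * (prob B - \<alpha>)"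
    using 1 by (simp add: algebra_simps)
  also have "\<dots> \<le> \<alpha> + p * (p ^ k * (1 - \<alpha>))"
    using Suc p by (intro add_left_mono mult_left_mono) (auto simp: B_def)
  finally show ?case by simp
qed
end

section \<open>The maximum of a jointly Gaussian family\<close>

theorem theorem3p4:
  fixes M :: "'a measure" and X :: "nat \<Rightarrow> 'a \<Rightarrow> real" and n :: nat
    and \<tau> \<sigma> \<alpha> N L :: real
  assumes "prob_space M"
    and "n \<ge> 1"
    and "jointly_gaussian M {1..n} X"
    and "\<And>i. i \<in> {1..n} \<Longrightarrow> prob_space.expectation M (X i) = 0"
    and "\<tau> \<ge> 0"
    and "\<tau>\<^sup>2 = Max ((\<lambda>i. prob_space.expectation M (\<lambda>\<omega>. (predictor M X i \<omega>)\<^sup>2)) ` {1..n})"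
    and "\<sigma> \<ge> 0"
    and "\<sigma>\<^sup>2 = Min ((\<lambda>i. prob_space.expectation M (\<lambda>\<omega>. (innovation M X i \<omega>)\<^sup>2)) ` {1..n})"
    and "0 < \<alpha>" and "\<alpha> < 1"
    and "N = ln ((real n)\<^sup>2 / (2 * pi))"
    and "L = - 2 * ln (- ln \<alpha>)"
    and "N + L \<ge> 6"
  shows "prob_space.prob M {\<omega> \<in> space M.
           Max ((\<lambda>i. X i \<omega>) ` {1..n})
             \<ge> \<sigma> * sqrt (N + L - ln (N + L)) + \<tau> * std_normal_quantile \<alpha>}
         \<ge> 1 - 2 * \<alpha>"
proof (cases "\<alpha> < 1 / 2")
  \<comment> \<open>For \<open>\<alpha>\<close> at least \<open>1 / 2\<close> the claimed lower
    bound is not positive. The other case ensures a nonpositive quantile.\<close>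
  case False
  then show ?thesis by (intro order_trans[OF _ measure_nonneg]) simp
next
  case True
  interpret prob_space M by fact
  note n = assms(2) and G = assms(3) and mean = assms(4)
  define c where "c = sqrt (N + L - ln (N + L))"
  define r where "r = \<sigma> * c"
  define t where "t = \<tau> * std_normal_quantile \<alpha>"
  have c0: "0 \<le> c" unfolding c_def using assms(13) ln_le_minus_one[of "N + L"] by simp
  have q: "std_normal_cdf (std_normal_quantile \<alpha>) = \<alpha>" "std_normal_quantile \<alpha> \<le> 0"
    using std_normal_cdf_quantile std_normal_quantile_nonpos assms(9,10) True by auto
  have tail: "std_normal_cdf c ^ n \<le> \<alpha>"
    unfolding c_def using assms by (intro std_normal_cdf_power_le) auto
  have GJ: "jointly_gaussian M {1..i} X" if "i \<in> {1..n}" for i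
    using jointly_gaussian_subset[OF G] that by auto
  have meas: "X i \<in> borel_measurable M" if "i \<in> {1..n}" for i
    using G that unfolding jointly_gaussian_def by blast
  have "\<forall>i\<in>{1..n}. \<exists>a. (AE \<omega> in M. predictor M X i \<omega> = (\<Sum>j\<in>{1..<i}. a j * X j \<omega>)) \<and>
    (\<forall>g\<in>borel_measurable (\<Pi>\<^sub>M j\<in>{1..<i}. borel).
      indep_var borel (\<lambda>\<omega>. X i \<omega> - (\<Sum>j\<in>{1..<i}. a j * X j \<omega>)) borel (\<lambda>\<omega>. g (\<lambda>j\<in>{1..<i}. X j \<omega>) :: real))"
    using GJ mean by (intro ballI gaussian_predictor) auto
  then obtain a where
    pred: "\<And>i. i \<in> {1..n} \<Longrightarrow> AE \<omega> in M. predictor M X i \<omega> = (\<Sum>j\<in>{1..<i}. a i j * X j \<omega>)"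
    and ind: "\<And>i g. i \<in> {1..n} \<Longrightarrow> g \<in> borel_measurable (\<Pi>\<^sub>M j\<in>{1..<i}. borel) \<Longrightarrow>
      indep_var borel (\<lambda>\<omega>. X i \<omega> - (\<Sum>j\<in>{1..<i}. a i j * X j \<omega>)) borel (\<lambda>\<omega>. g (\<lambda>j\<in>{1..<i}. X j \<omega>) :: real)"
    unfolding bchoice_iff by blast
  \<comment> \<open>\<open>E i\<close> is the linear version of the predictor, for which the
    Gaussian law and independence hold. Second moments pass between the two by almost sure
    equality.\<close>
  define E where "E i \<omega> = (\<Sum>j\<in>{1..<i}. a i j * X j \<omega>)" for i \<omega>
  have predE: "AE \<omega> in M. predictor M X i \<omega> = E i \<omega>" if "i \<in> {1..n}" for i
    unfolding E_def by (rule pred[OF that])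
  have mE: "E i \<in> borel_measurable M" if "i \<in> {1..n}" for i
    unfolding E_def using meas that by (auto intro!: borel_measurable_sum borel_measurable_times)
  have mpred: "predictor M X i \<in> borel_measurable M" for i
    unfolding predictor_def by (rule borel_measurable_cond_exp2)
  have gE: "gaussian_rv M (E i)" "expectation (E i) = 0" if i: "i \<in> {1..n}" for i
  proof -
    have sub: "{1..<i} \<subseteq> {1..i}" by auto
    have "expectation (X k) = 0" if "k \<in> {1..<i}" for k using mean[of k] that i by auto
    from jointly_gaussian_lincomb[OF GJ[OF i] finite_atLeastAtMost sub this]
    show "gaussian_rv M (E i)" "expectation (E i) = 0" unfolding E_def by auto
  qed
  have gR: "gaussian_rv M (\<lambda>\<omega>. X i \<omega> - E i \<omega>)" "expectation (\<lambda>\<omega>. X i \<omega> - E i \<omega>) = 0"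
    if i: "i \<in> {1..n}" for i
  proof -
    \<comment> \<open>These coefficients write the innovation as a combination of \<open>X 1\<close>
      to \<open>X i\<close>, so it is Gaussian too.\<close>
    let ?c = "\<lambda>k. if k = i then 1 else - a i k"
    have s: "{1..i} = insert i {1..<i}" using i by auto
    have "(\<Sum>k\<in>{1..<i}. ?c k * X k \<omega>) = - E i \<omega>" for \<omega>
      unfolding E_def sum_negf[symmetric] by (intro sum.cong) auto
    then have "(\<lambda>\<omega>. \<Sum>k\<in>{1..i}. ?c k * X k \<omega>) = (\<lambda>\<omega>. X i \<omega> - E i \<omega>)"
      unfolding s by simp
    moreover have "expectation (X k) = 0" if "k \<in> {1..i}" for k using mean[of k] that i by auto
    note jointly_gaussian_lincomb[OF GJ[OF i] finite_atLeastAtMost order_refl this, of ?c]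
    ultimately show "gaussian_rv M (\<lambda>\<omega>. X i \<omega> - E i \<omega>)" "expectation (\<lambda>\<omega>. X i \<omega> - E i \<omega>) = 0"
      by simp_all
  qed
  have "prob {\<omega> \<in> space M. \<forall>j\<in>{1..n}. X j \<omega> < r + t} \<le> \<alpha> + std_normal_cdf c ^ n * (1 - \<alpha>)"
  proof (rule prob_all_less_bound[where E=E])
    fix i assume i: "i \<in> {1..n}"
    let ?P = "\<Pi>\<^sub>M j\<in>{1..<i}. (borel :: real measure)"
    let ?V = "\<lambda>\<omega>. \<lambda>j\<in>{1..<i}. X j \<omega>"
    \<comment> \<open>\<open>S\<close> encodes survival of the past together with
      \<open>t \<le> E i \<omega>\<close> as a set of tuples; its indicator is the function
      \<open>g\<close> to which independence is applied.\<close>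
    define S where "S = {v \<in> space ?P. (\<forall>j\<in>{1..<i}. v j < r + t) \<and> t \<le> (\<Sum>j\<in>{1..<i}. a i j * v j)}"
    have S: "S \<in> sets ?P" unfolding S_def by measurable
    have "indep_var borel (\<lambda>\<omega>. X i \<omega> - E i \<omega>) borel (\<lambda>\<omega>. indicator S (?V \<omega>) :: real)"
      unfolding E_def using i S by (intro ind borel_measurable_indicator)
    from indep_varD[OF this, of "{r..}" "{1}"]
    have "prob ((\<lambda>\<omega>. (X i \<omega> - E i \<omega>, indicator S (?V \<omega>) :: real)) -` ({r..} \<times> {1}) \<inter> space M)
      = prob ((\<lambda>\<omega>. X i \<omega> - E i \<omega>) -` {r..} \<inter> space M) * prob ((\<lambda>\<omega>. indicator S (?V \<omega>) :: real) -` {1} \<inter> space M)"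
      by simp
    moreover have iff: "?V \<omega> \<in> S \<longleftrightarrow> (\<forall>j\<in>{1..<i}. X j \<omega> < r + t) \<and> t \<le> E i \<omega>" for \<omega>
      by (simp add: S_def space_PiM E_def)
    have "(\<lambda>\<omega>. (X i \<omega> - E i \<omega>, indicator S (?V \<omega>) :: real)) -` ({r..} \<times> {1}) \<inter> space M
        = {\<omega> \<in> space M. ((\<forall>j\<in>{1..<i}. X j \<omega> < r + t) \<and> t \<le> E i \<omega>) \<and> r \<le> X i \<omega> - E i \<omega>}"
      by (intro set_eqI) (auto simp only: vimage_eq Int_iff mem_Collect_eq mem_Times_iff fst_conv snd_conv atLeast_iff singleton_iff indicator_eq_1_iff iff)
    moreover have "(\<lambda>\<omega>. indicator S (?V \<omega>) :: real) -` {1} \<inter> space M = {\<omega> \<in> space M. (\<forall>j\<in>{1..<i}. X j \<omega> < r + t) \<and> t \<le> E i \<omega>}"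
      by (intro set_eqI) (auto simp only: vimage_eq Int_iff mem_Collect_eq mem_Times_iff fst_conv snd_conv atLeast_iff singleton_iff indicator_eq_1_iff iff)
    moreover have "(\<lambda>\<omega>. X i \<omega> - E i \<omega>) -` {r..} \<inter> space M = {\<omega> \<in> space M. r \<le> X i \<omega> - E i \<omega>}"
      by auto
    ultimately show "prob {\<omega> \<in> space M. ((\<forall>j\<in>{1..<i}. X j \<omega> < r + t) \<and> t \<le> E i \<omega>) \<and> r \<le> X i \<omega> - E i \<omega>}
      = prob {\<omega> \<in> space M. (\<forall>j\<in>{1..<i}. X j \<omega> < r + t) \<and> t \<le> E i \<omega>} * prob {\<omega> \<in> space M. r \<le> X i \<omega> - E i \<omega>}"
      by (simp only: mult.commute)
  next
    fix i assume i: "i \<in> {1..n}"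
    have "expectation (\<lambda>\<omega>. (E i \<omega>)\<^sup>2) = expectation (\<lambda>\<omega>. (predictor M X i \<omega>)\<^sup>2)"
      using predE[OF i] mE[OF i] mpred by (intro integral_cong_AE) auto
    also have "\<dots> \<le> \<tau>\<^sup>2" unfolding assms(6) using i by (intro Max_ge) auto
    finally have "sqrt (expectation (\<lambda>\<omega>. (E i \<omega>)\<^sup>2)) \<le> \<tau>"
      using assms(5) by (simp add: real_le_lsqrt)
    \<comment> \<open>The quantile is nonpositive, so replacing \<open>\<tau>\<close> by a smaller
      deviation raises the product.\<close>
    then have "t \<le> sqrt (expectation (\<lambda>\<omega>. (E i \<omega>)\<^sup>2)) * std_normal_quantile \<alpha>"
      unfolding t_def using q(2) by (rule mult_right_mono_neg)
    from prob_centered_gaussian_less[OF gE[OF i] this]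
    show "prob {\<omega> \<in> space M. E i \<omega> < t} \<le> \<alpha>" by (simp add: q)
  next
    fix i assume i: "i \<in> {1..n}"
    have "\<sigma>\<^sup>2 \<le> expectation (\<lambda>\<omega>. (innovation M X i \<omega>)\<^sup>2)" unfolding assms(8) using i by (intro Min_le) auto
    also have "\<dots> = expectation (\<lambda>\<omega>. (X i \<omega> - E i \<omega>)\<^sup>2)"
      using predE[OF i] mE[OF i] mpred meas[OF i]
      by (intro integral_cong_AE) (auto simp: innovation_def)
    finally have "\<sigma> \<le> sqrt (expectation (\<lambda>\<omega>. (X i \<omega> - E i \<omega>)\<^sup>2))"
      by (rule real_le_rsqrt)
    then have "r \<le> sqrt (expectation (\<lambda>\<omega>. (X i \<omega> - E i \<omega>)\<^sup>2)) * c"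
      unfolding r_def using c0 by (rule mult_right_mono)
    from prob_centered_gaussian_less[OF gR[OF i] this]
    show "prob {\<omega> \<in> space M. X i \<omega> - E i \<omega> < r} \<le> std_normal_cdf c" .
  qed (use meas mE std_normal_cdf_nonneg std_normal_cdf_le_1 in auto)
  \<comment> \<open>The factor \<open>1 - \<alpha>\<close> is enlarged to 1; the two error terms are
    then \<open>\<alpha>\<close> each.\<close>
  also have "\<dots> \<le> \<alpha> + \<alpha> * 1"
    using tail assms(9,10) by (intro add_left_mono mult_mono) auto
  finally have small: "prob {\<omega> \<in> space M. \<forall>j\<in>{1..n}. X j \<omega> < r + t} \<le> 2 * \<alpha>" by simp
  have "{\<omega> \<in> space M. r + t \<le> Max ((\<lambda>i. X i \<omega>) ` {1..n})}
      = space M - {\<omega> \<in> space M. \<forall>j\<in>{1..n}. X j \<omega> < r + t}"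
    using n by (auto simp: Max_ge_iff not_less)
  moreover have "{\<omega> \<in> space M. \<forall>j\<in>{1..n}. X j \<omega> < r + t} \<in> sets M"
    using meas by measurable
  ultimately have "1 - 2 * \<alpha> \<le> prob {\<omega> \<in> space M. r + t \<le> Max ((\<lambda>i. X i \<omega>) ` {1..n})}"
    using small by (simp only: prob_compl)
  then show ?thesis unfolding r_def t_def c_def .
qed

end
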